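(* Let $k,\ell\in\mathbb{N}$. The group $N_k\times N_\ell$ acts naturally on the set of $(k+\ell)$-dimensional indecomposable calibrated representations of $A$ with regular eigenvalues, and on the space of pairs consisting of a $k\times\ell$ rhizomatic matrix and a vector $(\underline{a},\underline{b})\in\mathbb{C}^{k+\ell,\mathrm{reg}}$ which parametrize these representations: $$(N_k\times N_\ell)\curvearrowright\widetilde{\mathcal{V}}_{k,\ell}:=\{(S,(\underline{a},\underline{b}))\mid S\in M_{k\times\ell}(\mathbb{C})\text{ is rhizomatic},\ (\underline{a},\underline{b})\in\mathbb{C}^{k+\ell,\mathrm{reg}}\}.$$
   Context: $A$ denotes the degenerate affine periplectic Brauer algebra on $2$ strands: the associative unital $\mathbb{C}$-algebra generated by $s,y_1,y_2,e$ with relations $$s^2=1,\quad y_1y_2=y_2y_1,\quad sy_1=y_2s-1-e,\quad sy_2=y_1s+1-e,$$ $$e^2=0,\quad es=e,\quad se=-e,\quad ey_2=ey_1+e,\quad y_1e=y_2e+e.$$ A representation of $A$ is called calibrated if it has a basis with respect to which $y_1$ and $y_2$ both act by diagonal matrices. A vector in $\mathbb{C}^{k+\ell}$ is written $(\underline{a},\underline{b})=(a_1,\dots,a_k,b_1,\dots,b_\ell)$, and $M_{k\times\ell}(\mathbb{C})$ is the set of $k\times\ell$ complex matrices. Regular eigenvalues: set $\mathbb{C}^{k+\ell,\mathrm{reg}}=\{(\underline{a},\underline{b})\in\mathbb{C}^{k+\ell}\mid a_i\neq a_j\text{ and } b_m\neq b_n\text{ for all }1\le i<j\le k,\ 1\le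 m<n\le\ell\}$. Suppose $V$ is a calibrated representation of $A$ such that $y_1-y_2$ acts on $V$ by $\begin{pmatrix}\mathrm{Id}_k&0\\0&-\mathrm{Id}_\ell\end{pmatrix}$ in an eigenbasis for $y_1$ and $y_2$. If $y_1$ acts on $V$ by $\mathrm{diag}(\underline{a},\underline{b})$ for some $(\underline{a},\underline{b})\in\mathbb{C}^{k+\ell,\mathrm{reg}}$, then $V$ is said to have regular eigenvalues. The pair $(S,(\underline{a},\underline{b}))$ corresponds to the calibrated representation $V_{k,\ell}(S;(\underline{a},\underline{b}))$ of $A$ on $\mathbb{C}^{k+\ell}$ given by $$y_1=\mathrm{diag}(a_1,\dots,a_k,b_1-1,\dots,b_\ell-1),\quad y_2=\mathrm{diag}(a_1-1,\dots,a_k-1,b_1,\dots,b_\ell),$$ $$s=\begin{pmatrix}-\mathrm{Id}_k&S\\0&\mathrm{Id}_\ell\end{pmatrix},\quad e=-sy_2+y_1s+\mathrm{Id}_{k+\ell}.$$ (Shifting all entries of $\underline{b}$ by $1$ does not affect membership in $\mathbb{C}^{k+\ell,\mathrm{reg}}$.) Rhizomatic matrices: for $S=(s_{ij})\in M_{k\times\ell}(\mathbb{C})$, let $\sim$ be the equivalence relation on the (positions of) nonzero entries of $S$ generated by $s_{ij}\sim s_{mn}$ whenever $i=m$ or $j=n$. $S$ is rhizomatic if (i) $S$ has a single equivalence class of nonzero entries under $\sim$, and (ii) $S$ has a nonzero entry in every row and column. $N_k\subset\mathrm{GL}_k(\mathbb{C})$ is the normalizer of the diagonal $k\times k$ matrices,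 i.e. the group of $k\times k$ matrices with exactly one nonzero entry in every row and column; similarly $N_\ell\subset\mathrm{GL}_\ell(\mathbb{C})$. Meaning of "acts naturally": $N_k\times N_\ell$ is embedded block-diagonally in $\mathrm{GL}_{k+\ell}(\mathbb{C})$ and acts on representations by simultaneous conjugation of the matrices of $y_1,y_2,s,e$; on pairs, $X_1=\sum_i\xi_i e_{i,\sigma(i)}\in N_k$ and $X_2=\sum_j\phi_j e_{j,\tau(j)}\in N_\ell$ (with $\xi_i,\phi_j\in\mathbb{C}^\times$, $\sigma\in S_k$, $\tau\in S_\ell$, $e_{i,j}$ matrix units) send $(S,(\underline{a},\underline{b}))$ to $(X_1SX_2^{-1},(a_{\sigma(1)},\dots,a_{\sigma(k)},b_{\tau(1)},\dots,b_{\tau(\ell)}))$.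
   Formalization: Here k,l ≥ 1. For k=l=1 the parametrization misses the indecomposable representations y1=diag(a,a-1), y2=diag(a-1,a), s=((-1,0),(r,1)), e=0, r≠0; these are removed from the parametrized set (not from the action). For all other k,l nothing is removed. *)

theory Defs
  imports "HOL-Analysis.Analysis" "HOL-Algebra.Group_Action"
begin

section \<open>The degenerate affine periplectic Brauer algebra on two strands\<close>

text \<open>
  Terms modulo the least congruence containing the axioms of unital associative
  \<open>\<complex>\<close>-algebras and the defining relations. Scalars act through the structure map:
  the multiple of \<open>t\<close> by \<open>c\<close> is \<open>Scal c * t\<close>.
\<close>

datatype alg_term =
  Scal complex | GenS | GenY1 | GenY2 | GenE | Add alg_term alg_term | Mul alg_term alg_term

instantiation alg_term :: "{zero, one, plus, times, uminus, minus}"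
begin
definition "0 = Scal 0"
definition "1 = Scal 1"
definition "t + u = Add t u"
definition "t * u = Mul t u"
definition "- t = Scal (-1) * (t :: alg_term)"
definition "t - u = t + - (u :: alg_term)"
instance ..
end

inductive alg_eq :: "alg_term \<Rightarrow> alg_term \<Rightarrow> bool" (infix "\<simeq>" 50) where
  refl: "t \<simeq> t"
| sym: "t \<simeq> u \<Longrightarrow> u \<simeq> t"
| trans: "t \<simeq> u \<Longrightarrow> u \<simeq> v \<Longrightarrow> t \<simeq> v"
| add_cong: "t \<simeq> t' \<Longrightarrow> u \<simeq> u' \<Longrightarrow> t + u \<simeq> t' + u'"
| mul_cong: "t \<simeq> t' \<Longrightarrow> u \<simeq> u' \<Longrightarrow> t * u \<simeq> t' * u'"
| add_assoc: "(t + u) + v \<simeq> t + (u + v)"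
| add_comm: "t + u \<simeq> u + t"
| add_zero: "0 + t \<simeq> t"
| add_neg: "- t + t \<simeq> 0"
| mul_assoc: "(t * u) * v \<simeq> t * (u * v)"
| mul_one_left: "1 * t \<simeq> t"
| mul_one_right: "t * 1 \<simeq> t"
| distrib_left: "t * (u + v) \<simeq> t * u + t * v"
| distrib_right: "(t + u) * v \<simeq> t * v + u * v"
| scal_add: "Scal (c + d) \<simeq> Scal c + Scal d"
| scal_mul: "Scal (c * d) \<simeq> Scal c * Scal d"
| scal_central: "Scal c * t \<simeq> t * Scal c"
| s_s: "GenS * GenS \<simeq> 1"
| y1_y2: "GenY1 * GenY2 \<simeq> GenY2 * GenY1"
| s_y1: "GenS * GenY1 \<simeq> GenY2 * GenS - 1 - GenE"
| s_y2: "GenS * GenY2 \<simeq> GenY1 * GenS + 1 - GenE"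
| e_e: "GenE * GenE \<simeq> 0"
| e_s: "GenE * GenS \<simeq> GenE"
| s_e: "GenS * GenE \<simeq> - GenE"
| e_y2: "GenE * GenY2 \<simeq> GenE * GenY1 + GenE"
| y1_e: "GenY1 * GenE \<simeq> GenY2 * GenE + GenE"

quotient_type periplectic = alg_term / alg_eq
proof (rule equivpI)
  show "reflp (\<simeq>)" by (auto intro: reflpI alg_eq.refl)
  show "symp (\<simeq>)" by (auto intro: sympI alg_eq.sym)
  show "transp (\<simeq>)" by (auto intro: transpI alg_eq.trans)
qed

lift_definition scal :: "complex \<Rightarrow> periplectic" is Scal .
lift_definition gen_s :: periplectic is GenS .
lift_definition gen_y1 :: periplectic is GenY1 .
lift_definition gen_y2 :: periplectic is GenY2 .
lift_definition gen_e :: periplectic is GenE .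

primrec eval ::
  "complex^'n^'n \<Rightarrow> complex^'n^'n \<Rightarrow> complex^'n^'n \<Rightarrow> complex^'n^'n \<Rightarrow> alg_term \<Rightarrow> complex^'n^'n"
where
  "eval s y1 y2 e (Scal c) = mat c"
| "eval s y1 y2 e GenS = s"
| "eval s y1 y2 e GenY1 = y1"
| "eval s y1 y2 e GenY2 = y2"
| "eval s y1 y2 e GenE = e"
| "eval s y1 y2 e (Add t u) = eval s y1 y2 e t + eval s y1 y2 e u"
| "eval s y1 y2 e (Mul t u) = eval s y1 y2 e t ** eval s y1 y2 e u"

definition satisfies_relations ::
  "complex^'n^'n \<Rightarrow> complex^'n^'n \<Rightarrow> complex^'n^'n \<Rightarrow> complex^'n^'n \<Rightarrow> bool" where
  "satisfies_relations s y1 y2 e \<longleftrightarrow>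
     s ** s = mat 1 \<and> y1 ** y2 = y2 ** y1 \<and>
     s ** y1 = y2 ** s - mat 1 - e \<and> s ** y2 = y1 ** s + mat 1 - e \<and>
     e ** e = 0 \<and> e ** s = e \<and> s ** e = - e \<and>
     e ** y2 = e ** y1 + e \<and> y1 ** e = y2 ** e + e"

lemma mat_zero [simp]: "mat 0 = (0 :: complex^'n^'n)"
  by (simp add: vec_eq_iff mat_def)

lemma mat_add: "mat (c + d) = (mat c + mat d :: complex^'n^'n)"
  by (simp add: vec_eq_iff mat_def)

lemma mat_mul_nth: "(mat c ** A) $ i $ j = c * (A :: complex^'m^'n) $ i $ j"
  by (simp add: matrix_matrix_mult_def mat_def if_distrib [where f = "\<lambda>x. x * _"]
      sum.delta' sum.delta cong: if_cong)

lemma mul_mat_nth: "(A ** mat c) $ i $ j = (A :: complex^'m^'n) $ i $ j * c"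
  by (simp add: matrix_matrix_mult_def mat_def if_distrib sum.delta' sum.delta cong: if_cong)

lemma matrix_add_rdistrib': "(A + B) ** C = A ** C + B ** (C :: complex^'m^'n)"
  by (simp add: vec_eq_iff matrix_matrix_mult_def sum.distrib algebra_simps)

lemma mat_neg_one [simp]: "mat (-1) ** A = - (A :: complex^'m^'n)"
  by (simp add: vec_eq_iff mat_mul_nth)

lemma eval_simps [simp]:
  "eval s y1 y2 e 0 = 0" "eval s y1 y2 e 1 = mat 1"
  "eval s y1 y2 e (t + u) = eval s y1 y2 e t + eval s y1 y2 e u"
  "eval s y1 y2 e (t * u) = eval s y1 y2 e t ** eval s y1 y2 e u"
  "eval s y1 y2 e (- t) = - eval s y1 y2 e t"
  "eval s y1 y2 e (t - u) = eval s y1 y2 e t - eval s y1 y2 e u"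
  by (simp_all add: zero_alg_term_def one_alg_term_def plus_alg_term_def times_alg_term_def
      uminus_alg_term_def minus_alg_term_def)

lemma eval_alg_eq:
  assumes "satisfies_relations s y1 y2 e" and "t \<simeq> u"
  shows "eval s y1 y2 e t = eval s y1 y2 e u"
  using assms(2)
proof (induction rule: alg_eq.induct)
  case (scal_mul c d)
  show ?case by (simp add: vec_eq_iff mat_mul_nth) (simp add: mat_def)
next
  case (scal_central c t)
  show ?case by (simp add: vec_eq_iff mat_mul_nth mul_mat_nth)
qed (use assms(1) in \<open>simp_all add: satisfies_relations_def mat_add matrix_mul_assoc
      matrix_add_ldistrib matrix_add_rdistrib' algebra_simps\<close>)

instantiation periplectic :: ring_1
begin
lift_definition zero_periplectic :: periplectic is 0 .
lift_definition one_periplectic :: periplectic is 1 .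
lift_definition plus_periplectic :: "periplectic \<Rightarrow> periplectic \<Rightarrow> periplectic" is "(+)"
  by (rule alg_eq.add_cong)
lift_definition times_periplectic :: "periplectic \<Rightarrow> periplectic \<Rightarrow> periplectic" is "(*)"
  by (rule alg_eq.mul_cong)
lift_definition uminus_periplectic :: "periplectic \<Rightarrow> periplectic" is uminus
  by (simp add: uminus_alg_term_def alg_eq.mul_cong alg_eq.refl)
lift_definition minus_periplectic :: "periplectic \<Rightarrow> periplectic \<Rightarrow> periplectic" is "(-)"
  by (simp add: uminus_alg_term_def minus_alg_term_def alg_eq.mul_cong alg_eq.add_cong alg_eq.refl)
instance
proof
  have rels: "satisfies_relations (mat (-1)) (mat 0) (mat (-1)) (0 :: complex^1^1)"
    by (simp add: satisfies_relations_def vec_eq_iff mat_mul_nth) (simp add: mat_def)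
  have "\<not> (0 :: alg_term) \<simeq> 1"
    using eval_alg_eq [OF rels, of 0 1] by (auto simp: vec_eq_iff mat_def)
  then show "(0 :: periplectic) \<noteq> 1" by transfer
qed (transfer, force simp: minus_alg_term_def intro: alg_eq.refl alg_eq.add_assoc
       alg_eq.add_comm alg_eq.add_zero alg_eq.add_neg alg_eq.mul_assoc alg_eq.mul_one_left
       alg_eq.mul_one_right alg_eq.distrib_left alg_eq.distrib_right)+
end


section \<open>Representations\<close>

text \<open>Unital \<open>\<complex>\<close>-algebra homomorphisms to the \<open>n \<times> n\<close> matrices; unitality is the case
  \<open>c = 1\<close> of the last clause.\<close>

definition representation :: "(periplectic \<Rightarrow> complex^'n^'n) \<Rightarrow> bool" where
  "representation \<rho> \<longleftrightarrow>
     (\<forall>x y. \<rho> (x + y) = \<rho> x + \<rho> y) \<and> (\<forall>x y. \<rho> (x * y) = \<rho> x ** \<rho> y) \<and>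
     (\<forall>c. \<rho> (scal c) = mat c)"

lemma ex1_representation:
  assumes "satisfies_relations s y1 y2 e"
  shows "\<exists>!\<rho>. representation \<rho> \<and>
    \<rho> gen_y1 = y1 \<and> \<rho> gen_y2 = y2 \<and> \<rho> gen_s = s \<and> \<rho> gen_e = e"
proof (rule ex_ex1I)
  let ?ev = "eval s y1 y2 e"
  define \<rho> where "\<rho> x = ?ev (rep_periplectic x)" for x
  have abs: "\<rho> (abs_periplectic t) = ?ev t" for t
    unfolding \<rho>_def
    by (rule eval_alg_eq [OF assms]) (metis Quotient3_periplectic rep_abs_rsp_left alg_eq.refl)
  have ex: "\<exists>t. x = abs_periplectic t" for x
    by (metis Quotient3_periplectic Quotient3_abs_rep)
  have "\<rho> (x + y) = \<rho> x + \<rho> y" for x y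
    using ex [of x] ex [of y] by (auto simp: abs plus_periplectic.abs_eq)
  moreover have "\<rho> (x * y) = \<rho> x ** \<rho> y" for x y
    using ex [of x] ex [of y] by (auto simp: abs times_periplectic.abs_eq)
  ultimately show "\<exists>\<rho>. representation \<rho> \<and>
      \<rho> gen_y1 = y1 \<and> \<rho> gen_y2 = y2 \<and> \<rho> gen_s = s \<and> \<rho> gen_e = e"
    by (intro exI [of _ \<rho>])
      (auto simp: representation_def abs scal.abs_eq gen_s_def gen_y1_def gen_y2_def gen_e_def)
next
  fix \<rho> \<rho>'
  assume h: "representation \<rho> \<and>
      \<rho> gen_y1 = y1 \<and> \<rho> gen_y2 = y2 \<and> \<rho> gen_s = s \<and> \<rho> gen_e = e"
    and h': "representation \<rho>' \<and>
      \<rho>' gen_y1 = y1 \<and> \<rho>' gen_y2 = y2 \<and> \<rho>' gen_s = s \<and> \<rho>' gen_e = e"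
  have "\<rho> (abs_periplectic t) = \<rho>' (abs_periplectic t)" for t
  proof (induction t)
    case (Add t u)
    then show ?case using h h'
      by (simp add: representation_def plus_periplectic.abs_eq [symmetric] flip: plus_alg_term_def)
  next
    case (Mul t u)
    then show ?case using h h'
      by (simp add: representation_def times_periplectic.abs_eq [symmetric] flip: times_alg_term_def)
  qed (use h h' in \<open>auto simp: representation_def gen_s_def gen_y1_def gen_y2_def gen_e_def
         simp flip: scal.abs_eq\<close>)
  then show "\<rho> = \<rho>'"
    by (metis Quotient3_periplectic Quotient3_abs_rep ext)
qed

definition subrepresentation :: "(periplectic \<Rightarrow> complex^'n^'n) \<Rightarrow> (complex^'n) set \<Rightarrow> bool" where
  "subrepresentation \<rho> U \<longleftrightarrow> vec.subspace U \<and> (\<forall>x. \<forall>u\<in>U. \<rho> x *v u \<in> U)"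

text \<open>The space \<open>\<complex>\<^sup>n\<close> is never zero here, as index types are nonempty.\<close>

definition indecomposable :: "(periplectic \<Rightarrow> complex^'n^'n) \<Rightarrow> bool" where
  "indecomposable \<rho> \<longleftrightarrow>
     \<not> (\<exists>U W. subrepresentation \<rho> U \<and> subrepresentation \<rho> W \<and> U \<noteq> {0} \<and> W \<noteq> {0} \<and>
              U \<inter> W = {0} \<and> (\<forall>v. \<exists>u\<in>U. \<exists>w\<in>W. v = u + w))"

definition diag :: "complex^'n \<Rightarrow> complex^'n^'n" where
  "diag d = (\<chi> i j. if i = j then d $ i else 0)"

definition calibrated :: "(periplectic \<Rightarrow> complex^'n^'n) \<Rightarrow> bool" where
  "calibrated \<rho> \<longleftrightarrow>
     (\<exists>P :: complex^'n^'n. invertible P \<and> matrix_inv P ** \<rho> gen_y1 ** P \<in> range diag \<and>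
          matrix_inv P ** \<rho> gen_y2 ** P \<in> range diag)"

definition block :: "complex^'k^'k \<Rightarrow> complex^'l^'k \<Rightarrow> complex^'k^'l \<Rightarrow> complex^'l^'l \<Rightarrow>
    complex^('k::finite + 'l::finite)^('k::finite + 'l::finite)" where
  "block A B C D = (\<chi> p q. case p of
       Inl i \<Rightarrow> (case q of Inl j \<Rightarrow> A $ i $ j | Inr j \<Rightarrow> B $ i $ j)
     | Inr i \<Rightarrow> (case q of Inl j \<Rightarrow> C $ i $ j | Inr j \<Rightarrow> D $ i $ j))"

definition regular_vectors :: "(complex^('k::finite + 'l::finite)) set" where
  "regular_vectors = {v. inj (\<lambda>i. v $ Inl i) \<and> inj (\<lambda>j. v $ Inr j)}"

definition regular_eigenvalues :: "(periplectic \<Rightarrow> complex^('k::finite + 'l::finite)^('k::finite + 'l::finite)) \<Rightarrow> bool" where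
  "regular_eigenvalues \<rho> \<longleftrightarrow>
     \<rho> gen_y1 - \<rho> gen_y2 = block (mat 1) 0 0 (- mat 1) \<and>
     (\<exists>v \<in> regular_vectors. \<rho> gen_y1 = diag v)"

definition regular_reps :: "(periplectic \<Rightarrow> complex^('k::finite + 'l::finite)^('k::finite + 'l::finite)) set" where
  "regular_reps =
     {\<rho>. representation \<rho> \<and> calibrated \<rho> \<and> indecomposable \<rho> \<and> regular_eigenvalues \<rho>}"

section \<open>The parametrizing pairs\<close>

definition nonzero_positions :: "complex^'l^'k \<Rightarrow> ('k \<times> 'l) set" where
  "nonzero_positions S = {(i, j). S $ i $ j \<noteq> 0}"

definition adjacent :: "complex^'l^'k \<Rightarrow> 'k \<times> 'l \<Rightarrow> 'k \<times> 'l \<Rightarrow> bool" where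
  "adjacent S p q \<longleftrightarrow> p \<in> nonzero_positions S \<and> q \<in> nonzero_positions S \<and>
     (fst p = fst q \<or> snd p = snd q)"

definition position_equiv :: "complex^'l^'k \<Rightarrow> (('k \<times> 'l) \<times> ('k \<times> 'l)) set" where
  "position_equiv S = {(p, q). p \<in> nonzero_positions S \<and> q \<in> nonzero_positions S \<and>
     equivclp (adjacent S) p q}"

definition rhizomatic :: "complex^'l^'k \<Rightarrow> bool" where
  "rhizomatic S \<longleftrightarrow>
     card (nonzero_positions S // position_equiv S) = 1 \<and>
     (\<forall>i. \<exists>j. S $ i $ j \<noteq> 0) \<and> (\<forall>j. \<exists>i. S $ i $ j \<noteq> 0)"

definition rhizomatic_pairs :: "((complex^'l^'k) \<times> (complex^('k::finite + 'l::finite))) set" where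
  "rhizomatic_pairs = {S. rhizomatic S} \<times> regular_vectors"

definition shift_left :: "complex^('k::finite + 'l::finite) \<Rightarrow> complex^('k::finite + 'l::finite)" where
  "shift_left v = (\<chi> p. case p of Inl i \<Rightarrow> v $ p - 1 | Inr j \<Rightarrow> v $ p)"

definition shift_right :: "complex^('k::finite + 'l::finite) \<Rightarrow> complex^('k::finite + 'l::finite)" where
  "shift_right v = (\<chi> p. case p of Inl i \<Rightarrow> v $ p | Inr j \<Rightarrow> v $ p - 1)"

definition pair_s :: "complex^'l^'k \<Rightarrow> complex^('k::finite + 'l::finite)^('k::finite + 'l::finite)" where
  "pair_s S = block (- mat 1) S 0 (mat 1)"

definition pair_y1 :: "complex^('k::finite + 'l::finite) \<Rightarrow> complex^('k::finite + 'l::finite)^('k::finite + 'l::finite)" where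
  "pair_y1 v = diag (shift_right v)"

definition pair_y2 :: "complex^('k::finite + 'l::finite) \<Rightarrow> complex^('k::finite + 'l::finite)^('k::finite + 'l::finite)" where
  "pair_y2 v = diag (shift_left v)"

definition pair_e :: "complex^'l^'k \<Rightarrow> complex^('k::finite + 'l::finite) \<Rightarrow> complex^('k::finite + 'l::finite)^('k::finite + 'l::finite)" where
  "pair_e S v = - (pair_s S ** pair_y2 v) + pair_y1 v ** pair_s S + mat 1"

definition rep_of_pair ::
  "(complex^'l^'k) \<times> (complex^('k::finite + 'l::finite)) \<Rightarrow> periplectic \<Rightarrow> complex^('k::finite + 'l::finite)^('k::finite + 'l::finite)" where
  "rep_of_pair = (\<lambda>(S, v). THE \<rho>. representation \<rho> \<and>
     \<rho> gen_y1 = pair_y1 v \<and> \<rho> gen_y2 = pair_y2 v \<and> \<rho> gen_s = pair_s S \<and> \<rho> gen_e = pair_e S v)"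

lemma sum_UNIV_sum: "sum f (UNIV :: ('k::finite + 'l::finite) set) =
    (\<Sum>i\<in>UNIV. f (Inl i)) + (\<Sum>j\<in>UNIV. f (Inr j))"
  by (simp add: sum.Plus flip: UNIV_Plus_UNIV)

lemma block_nth [simp]:
  "block A B C D $ Inl i $ Inl j = A $ i $ j"
  "block A B C D $ Inl i $ Inr m = B $ i $ m"
  "block A B C D $ Inr n $ Inl j = C $ n $ j"
  "block A B C D $ Inr n $ Inr m = D $ n $ m"
  by (simp_all add: block_def)

lemma vec_eq_sum_iff:
  "(v :: 'a^('k::finite + 'l::finite)) = w \<longleftrightarrow>
     (\<forall>i. v $ Inl i = w $ Inl i) \<and> (\<forall>j. v $ Inr j = w $ Inr j)"
  by (simp add: vec_eq_iff split_sum_all)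

lemma block_mult:
  "block A B C D ** block A' B' C' D' =
   block (A ** A' + B ** C') (A ** B' + B ** D') (C ** A' + D ** C') (C ** B' + D ** D')"
  by (simp add: vec_eq_sum_iff matrix_matrix_mult_def sum_UNIV_sum)

lemma diag_mult_nth: "(diag d ** A) $ i $ j = d $ i * A $ i $ j"
  by (simp add: diag_def matrix_matrix_mult_def if_distrib [where f = "\<lambda>x. x * _"]
      sum.delta' sum.delta cong: if_cong)

lemma mult_diag_nth: "(A ** diag d) $ i $ j = A $ i $ j * d $ j"
  by (simp add: diag_def matrix_matrix_mult_def if_distrib sum.delta' sum.delta cong: if_cong)

lemma pair_e_eq: "pair_e S v = block 0 (\<chi> i j. (v $ Inl i - v $ Inr j) * S $ i $ j) 0 0"
  by (simp add: vec_eq_sum_iff vec_eq_iff pair_e_def pair_s_def pair_y1_def pair_y2_def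
      diag_mult_nth mult_diag_nth shift_left_def shift_right_def mat_def algebra_simps)

lemma block_eqs:
  "block 0 0 0 0 = 0" "block (mat c) 0 0 (mat c) = mat c"
  "- block A B C D = block (- A) (- B) (- C) (- D)"
  by (simp_all add: vec_eq_sum_iff) (simp_all add: mat_def vec_eq_iff)

lemma satisfies_relations_block:
  fixes S :: "complex^'l^'k" and R :: "complex^'k^'l" and v :: "complex^('k::finite + 'l::finite)"
  defines "E \<equiv> \<chi> i j. (v $ Inl i - v $ Inr j) * S $ i $ j"
  assumes prods: "S ** R = 0" "R ** S = 0" "E ** R = 0" "R ** E = 0"
    and R: "\<And>i j. v $ Inl i \<noteq> v $ Inr j \<Longrightarrow> R $ j $ i = 0"
  shows "satisfies_relations (block (- mat 1) S R (mat 1)) (pair_y1 v) (pair_y2 v) (block 0 E 0 0)"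
proof -
  have neg: "- mat 1 ** A = - A" "A ** - mat 1 = - A" for A :: "complex^'m^'n"
  proof -
    have 1: "- mat 1 = (mat (-1) :: complex^'n^'n)" and 2: "- mat 1 = (mat (-1) :: complex^'m^'m)"
      by (simp_all add: vec_eq_iff mat_def)
    show "- mat 1 ** A = - A" "A ** - mat 1 = - A"
      unfolding 1 2 by (simp_all add: vec_eq_iff mul_mat_nth)
  qed
  have R': "v $ Inl i * R $ j $ i = v $ Inr j * R $ j $ i" for i j
    using R [of i j] by fastforce
  show ?thesis
    unfolding satisfies_relations_def
  proof (intro conjI)
    show "block (- mat 1) S R (mat 1) ** block (- mat 1) S R (mat 1) = mat 1"
      by (simp add: block_mult neg prods block_eqs)
    show "pair_y1 v ** pair_y2 v = pair_y2 v ** pair_y1 v"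
      by (simp add: vec_eq_iff pair_y1_def pair_y2_def diag_mult_nth) (simp add: diag_def)
  qed (simp_all add: block_mult neg prods block_eqs,
      simp_all add: vec_eq_sum_iff vec_eq_iff pair_y1_def pair_y2_def
        diag_mult_nth mult_diag_nth shift_left_def shift_right_def mat_def E_def R'
        algebra_simps)
qed

lemma satisfies_relations_pair:
  "satisfies_relations (pair_s S) (pair_y1 v) (pair_y2 v) (pair_e S v)"
  unfolding pair_e_eq pair_s_def by (rule satisfies_relations_block) simp_all

lemma rep_of_pair:
  fixes S :: "complex^'l^'k" and v :: "complex^('k::finite + 'l::finite)"
  defines "\<rho> \<equiv> rep_of_pair (S, v)"
  shows "representation \<rho>" "\<rho> gen_y1 = pair_y1 v" "\<rho> gen_y2 = pair_y2 v"
    "\<rho> gen_s = pair_s S" "\<rho> gen_e = pair_e S v"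
  using theI' [OF ex1_representation [OF satisfies_relations_pair [of S v]]]
  by (simp_all add: \<rho>_def rep_of_pair_def)

section \<open>The group and its actions\<close>

definition monomial_matrices :: "(complex^'n^'n) set" where
  "monomial_matrices = {X. (\<forall>i. \<exists>!j. X $ i $ j \<noteq> 0) \<and> (\<forall>j. \<exists>!i. X $ i $ j \<noteq> 0)}"

lemma monomial_matrices_eq_normalizer:
  "monomial_matrices =
     {X :: complex^'n^'n. invertible X \<and> (\<lambda>D. X ** D ** matrix_inv X) ` range diag = range diag}"
proof (intro Set.equalityI subsetI)
  fix X :: "complex^'n^'n" assume X: "X \<in> monomial_matrices"
  define Y :: "complex^'n^'n" where "Y = (\<chi> j i. inverse (X $ i $ j))"
  have row: "X $ i $ j \<noteq> 0 \<Longrightarrow> X $ i $ j' \<noteq> 0 \<Longrightarrow> j = j'"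
    and col: "X $ i $ j \<noteq> 0 \<Longrightarrow> X $ i' $ j \<noteq> 0 \<Longrightarrow> i = i'" for i i' j j'
    using X unfolding monomial_matrices_def by blast+
  have ex: "\<exists>j. X $ i $ j \<noteq> 0" for i using X unfolding monomial_matrices_def by blast
  obtain \<sigma> where \<sigma>: "X $ i $ \<sigma> i \<noteq> 0" for i using ex by metis
  have X_zero: "j \<noteq> \<sigma> i \<Longrightarrow> X $ i $ j = 0" for i j
    using row \<sigma> by metis
  have inj: "inj \<sigma>" using \<sigma> col by (metis injI)
  then have bij: "bij \<sigma>" by (simp add: bij_def finite_UNIV_inj_surj)
  have conj: "X ** diag d ** Y = diag (\<chi> i. d $ \<sigma> i)" for d
  proof -
    have "(X ** diag d ** Y) $ i $ k = diag (\<chi> i. d $ \<sigma> i) $ i $ k" for i k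
    proof -
      have "(X ** diag d ** Y) $ i $ k = (\<Sum>j\<in>UNIV. X $ i $ j * d $ j * inverse (X $ k $ j))"
        by (subst matrix_matrix_mult_def) (simp add: mult_diag_nth Y_def)
      also have "\<dots> = (\<Sum>j\<in>UNIV. if j = \<sigma> i then X $ i $ j * d $ j * inverse (X $ k $ j) else 0)"
        by (rule sum.cong) (auto simp: X_zero)
      also have "\<dots> = X $ i $ \<sigma> i * d $ \<sigma> i * inverse (X $ k $ \<sigma> i)"
        by simp
      also have "\<dots> = diag (\<chi> i. d $ \<sigma> i) $ i $ k"
        using \<sigma> [of i] col [of i "\<sigma> i" k] by (auto simp: diag_def)
      finally show ?thesis .
    qed
    then show ?thesis by (simp add: vec_eq_iff)
  qed
  have one: "diag (\<chi> i. 1) = (mat 1 :: complex^'n^'n)" by (simp add: diag_def mat_def vec_eq_iff)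
  have XY: "X ** Y = mat 1" using conj [of "\<chi> i. 1"] by (simp add: one)
  then have YX: "Y ** X = mat 1" by (simp add: matrix_left_right_inverse)
  have inv: "invertible X" using XY YX by (auto simp: invertible_def)
  have "X ** matrix_inv X = mat 1 \<and> matrix_inv X ** X = mat 1"
    unfolding matrix_inv_def by (rule someI [of _ Y]) (simp add: XY YX)
  then have Yeq: "matrix_inv X = Y" by (metis YX matrix_mul_assoc matrix_mul_lid matrix_mul_rid)
  have "diag d \<in> (\<lambda>D. X ** D ** matrix_inv X) ` range diag" for d
  proof -
    have "diag d = X ** diag (\<chi> j. d $ (inv_into UNIV \<sigma> j)) ** matrix_inv X"
      unfolding Yeq conj by (simp add: inj inv_f_f)
    then show ?thesis by blast
  qed
  then show "X \<in> {X. invertible X \<and> (\<lambda>D. X ** D ** matrix_inv X) ` range diag = range diag}"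
    using inv conj by (auto simp: Yeq)
next
  fix X :: "complex^'n^'n"
  assume "X \<in> {X. invertible X \<and> (\<lambda>D. X ** D ** matrix_inv X) ` range diag = range diag}"
  then have inv: "invertible X" and
    nrm: "(\<lambda>D. X ** D ** matrix_inv X) ` range diag = range diag" by auto
  define Y where "Y = matrix_inv X"
  have Y: "X ** Y = mat 1" "Y ** X = mat 1"
    unfolding Y_def matrix_inv_def using inv unfolding invertible_def
    by (metis (mono_tags, lifting) someI_ex)+
  have unique_col: "i = i'" if "X $ i $ j \<noteq> 0" "X $ i' $ j \<noteq> 0" for i i' j
  proof -
    define d :: "complex^'n" where "d = axis i 1"
    obtain d' where d': "diag d = X ** diag d' ** Y"
      using nrm unfolding Y_def by (metis (no_types, lifting) image_iff rangeI)
    then have "diag d ** X = X ** diag d'"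
      by (metis Y(2) matrix_mul_assoc matrix_mul_rid)
    then have "d $ p * X $ p $ j = X $ p $ j * d' $ j" for p
      by (metis diag_mult_nth mult_diag_nth)
    from this [of i] this [of i'] that show ?thesis
      by (auto simp: d_def axis_def split: if_splits)
  qed
  have unique_row: "j = j'" if "X $ i $ j \<noteq> 0" "X $ i $ j' \<noteq> 0" for i j j'
  proof -
    define d :: "complex^'n" where "d = axis j 1"
    obtain d' where d': "X ** diag d ** Y = diag d'"
      using nrm unfolding Y_def by blast
    then have "diag d' ** X = X ** diag d"
      by (metis Y(2) matrix_mul_assoc matrix_mul_rid)
    then have "d' $ i * X $ i $ q = X $ i $ q * d $ q" for q
      by (metis diag_mult_nth mult_diag_nth)
    from this [of j] this [of j'] that show ?thesis
      by (auto simp: d_def axis_def split: if_splits)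
  qed
  have "\<exists>j. X $ i $ j \<noteq> 0" for i
  proof (rule ccontr)
    assume "\<not> (\<exists>j. X $ i $ j \<noteq> 0)"
    then have "(X ** Y) $ i $ i = 0" by (simp add: matrix_matrix_mult_def)
    then show False by (simp add: Y mat_def)
  qed
  moreover have "\<exists>i. X $ i $ j \<noteq> 0" for j
  proof (rule ccontr)
    assume "\<not> (\<exists>i. X $ i $ j \<noteq> 0)"
    then have "(Y ** X) $ j $ j = 0" by (simp add: matrix_matrix_mult_def)
    then show False by (simp add: Y mat_def)
  qed
  ultimately show "X \<in> monomial_matrices"
    unfolding monomial_matrices_def using unique_row unique_col by blast
qed

definition monomial_group :: "(complex^'n^'n) monoid" where
  "monomial_group = \<lparr>carrier = monomial_matrices, mult = (**), one = mat 1\<rparr>"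

definition rep_action :: "(complex^'k^'k) \<times> (complex^'l^'l) \<Rightarrow>
    (periplectic \<Rightarrow> complex^('k::finite + 'l::finite)^('k::finite + 'l::finite)) \<Rightarrow> periplectic \<Rightarrow> complex^('k::finite + 'l::finite)^('k::finite + 'l::finite)" where
  "rep_action = (\<lambda>(X, Y) \<rho> x. block X 0 0 Y ** \<rho> x ** matrix_inv (block X 0 0 Y))"

text \<open>For \<open>X = \<Sum>\<^sub>i \<xi>\<^sub>i e\<^sub>i\<^sub>,\<^sub>\<sigma>\<^sub>(\<^sub>i\<^sub>)\<close> this is the permutation \<open>\<sigma>\<close>.\<close>

definition monomial_perm :: "complex^'n^'n \<Rightarrow> 'n \<Rightarrow> 'n" where
  "monomial_perm X i = (THE j. X $ i $ j \<noteq> 0)"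

definition pair_action :: "(complex^'k^'k) \<times> (complex^'l^'l) \<Rightarrow>
    (complex^'l^'k) \<times> (complex^('k::finite + 'l::finite)) \<Rightarrow> (complex^'l^'k) \<times> (complex^('k::finite + 'l::finite))" where
  "pair_action = (\<lambda>(X, Y) (S, v).
     (X ** S ** matrix_inv Y,
      \<chi> p. case p of Inl i \<Rightarrow> v $ Inl (monomial_perm X i) | Inr j \<Rightarrow> v $ Inr (monomial_perm Y j)))"

section \<open>An exceptional family for \<open>k = l = 1\<close>\<close>

text \<open>
  For \<open>k = l = 1\<close>, \<open>a \<in> \<complex>\<close> and \<open>r \<noteq> 0\<close> the matrices \<open>y\<^sub>1 = diag(a, a - 1)\<close>,
  \<open>y\<^sub>2 = diag(a - 1, a)\<close>, \<open>s = ((-1, 0), (r, 1))\<close>, \<open>e = 0\<close> define an indecomposable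
  calibrated representation with regular eigenvalues in which \<open>s\<close> is not upper triangular,
  so it does not arise from a pair (\<open>exceptional_exists\<close>, \<open>exceptional_reps_subset\<close>,
  \<open>exceptional_not_rep_of_pair\<close>). For all other \<open>(k, l)\<close> the family is empty.
\<close>

definition exceptional_reps :: "(periplectic \<Rightarrow> complex^('k::finite + 'l::finite)^('k::finite + 'l::finite)) set" where
  "exceptional_reps = {\<rho>. representation \<rho> \<and> CARD('k) = 1 \<and> CARD('l) = 1 \<and>
     (\<exists>a r. r \<noteq> 0 \<and>
        \<rho> gen_y1 = block (mat a) 0 0 (mat (a - 1)) \<and>
        \<rho> gen_y2 = block (mat (a - 1)) 0 0 (mat a) \<and>
        \<rho> gen_s = block (- mat 1) 0 (\<chi> i j. r) (mat 1) \<and>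
        \<rho> gen_e = 0)}"

lemma exceptional_reps_empty:
  "CARD('k::finite) \<noteq> 1 \<or> CARD('l::finite) \<noteq> 1 \<Longrightarrow>
     (exceptional_reps :: (periplectic \<Rightarrow> complex^('k + 'l)^('k + 'l)) set) = {}"
  by (auto simp: exceptional_reps_def)

lemma exceptional_not_rep_of_pair:
  "rep_of_pair p \<notin> exceptional_reps"
proof
  assume "rep_of_pair p \<in> exceptional_reps"
  then obtain r where "r \<noteq> 0" "pair_s (fst p) = block (- mat 1) 0 (\<chi> i j. r) (mat 1)"
    using rep_of_pair(4) [of "fst p" "snd p"] by (auto simp: exceptional_reps_def)
  then show False
    by (auto simp: pair_s_def vec_eq_sum_iff vec_eq_iff)
qed

lemma exceptional_exists:
  fixes a r :: complex
  assumes "CARD('k::finite) = 1" "CARD('l::finite) = 1" "r \<noteq> 0"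
  shows "\<exists>\<rho> :: periplectic \<Rightarrow> complex^('k + 'l)^('k + 'l). \<rho> \<in> exceptional_reps \<and>
    \<rho> gen_y1 = block (mat a) 0 0 (mat (a - 1)) \<and>
    \<rho> gen_s = block (- mat 1) 0 (\<chi> i j. r) (mat 1)"
proof -
  define v :: "complex^('k + 'l)" where "v = (\<chi> p. a)"
  have y1: "pair_y1 v = block (mat a) 0 0 (mat (a - 1))"
    and y2: "pair_y2 v = block (mat (a - 1)) 0 0 (mat a)"
    by (simp_all add: vec_eq_sum_iff vec_eq_iff pair_y1_def pair_y2_def diag_def
        shift_left_def shift_right_def v_def mat_def)
  have zero: "(\<chi> i j. (v $ Inl i - v $ Inr j) * (0 :: complex^'l^'k) $ i $ j) = 0"
    by (simp add: vec_eq_iff)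
  have "satisfies_relations (block (- mat 1) 0 (\<chi> i j. r) (mat 1)) (pair_y1 v) (pair_y2 v)
      (block 0 (\<chi> i j. (v $ Inl i - v $ Inr j) * (0 :: complex^'l^'k) $ i $ j) 0 0)"
    unfolding zero by (rule satisfies_relations_block [where S = 0 and v = v, unfolded zero])
      (simp_all add: v_def)
  then have "satisfies_relations (block (- mat 1) (0 :: complex^'l^'k) (\<chi> i j. r) (mat 1))
      (block (mat a) 0 0 (mat (a - 1))) (block (mat (a - 1)) 0 0 (mat a)) 0"
    unfolding zero by (simp add: y1 y2 block_eqs)
  from ex1_implies_ex [OF ex1_representation [OF this]] show ?thesis
    using assms unfolding exceptional_reps_def by blast
qed

lemma exceptional_reps_subset:
  "(exceptional_reps :: (periplectic \<Rightarrow> complex^('k::finite + 'l::finite)^('k + 'l)) set) \<subseteq> regular_reps"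
proof
  fix \<rho> :: "periplectic \<Rightarrow> complex^('k + 'l)^('k + 'l)"
  assume "\<rho> \<in> exceptional_reps"
  then obtain a r where rep: "representation \<rho>" and card: "CARD('k) = 1" "CARD('l) = 1"
    and r: "r \<noteq> 0"
    and y1: "\<rho> gen_y1 = block (mat a) 0 0 (mat (a - 1))"
    and y2: "\<rho> gen_y2 = block (mat (a - 1)) 0 0 (mat a)"
    and s: "\<rho> gen_s = block (- mat 1) 0 (\<chi> i j. r) (mat 1)"
    by (auto simp: exceptional_reps_def)
  obtain k0 where k0: "(UNIV :: 'k set) = {k0}" using card(1) by (auto simp: card_1_singleton_iff)
  obtain l0 where l0: "(UNIV :: 'l set) = {l0}" using card(2) by (auto simp: card_1_singleton_iff)
  have all_k: "(\<forall>i :: 'k. P i) \<longleftrightarrow> P k0" for P using k0 by (metis UNIV_I singletonD)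
  have all_l: "(\<forall>i :: 'l. P i) \<longleftrightarrow> P l0" for P using l0 by (metis UNIV_I singletonD)
  have diag1: "\<rho> gen_y1 = diag (\<chi> p. case p of Inl i \<Rightarrow> a | Inr j \<Rightarrow> a - 1)"
    and diag2: "\<rho> gen_y2 = diag (\<chi> p. case p of Inl i \<Rightarrow> a - 1 | Inr j \<Rightarrow> a)"
    by (simp_all add: y1 y2 vec_eq_sum_iff vec_eq_iff diag_def mat_def)
  have inv1: "matrix_inv (mat 1) = (mat 1 :: complex^('k + 'l)^('k + 'l))"
    by (simp add: matrix_inv_def)
  have cal: "calibrated \<rho>"
    unfolding calibrated_def
    by (intro exI [of _ "mat 1"]) (simp add: inv1 diag1 diag2 invertible_def)
  have reg: "regular_eigenvalues \<rho>"
    unfolding regular_eigenvalues_def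
  proof (intro conjI bexI)
    show "\<rho> gen_y1 - \<rho> gen_y2 = block (mat 1) 0 0 (- mat 1)"
      by (simp add: y1 y2 vec_eq_sum_iff vec_eq_iff mat_def)
    show "(\<chi> p. case p of Inl i \<Rightarrow> a | Inr j \<Rightarrow> a - 1) \<in> (regular_vectors :: (complex^('k + 'l)) set)"
      by (auto simp: regular_vectors_def inj_def all_k all_l)
  qed (rule diag1)
  have mv: "(A *v u) $ Inl k0 = A $ Inl k0 $ Inl k0 * u $ Inl k0 + A $ Inl k0 $ Inr l0 * u $ Inr l0"
    "(A *v u) $ Inr l0 = A $ Inr l0 $ Inl k0 * u $ Inl k0 + A $ Inr l0 $ Inr l0 * u $ Inr l0"
    for A :: "complex^('k + 'l)^('k + 'l)" and u
    by (simp_all add: matrix_vector_mult_def sum_UNIV_sum k0 l0)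
  have eq_iff: "u = w \<longleftrightarrow> u $ Inl k0 = w $ Inl k0 \<and> u $ Inr l0 = w $ Inr l0"
    for u w :: "complex^('k + 'l)"
    by (simp add: vec_eq_sum_iff all_k all_l)
  define e2 :: "complex^('k + 'l)" where "e2 = axis (Inr l0) 1"
  have e2: "e2 $ Inl k0 = 0" "e2 $ Inr l0 = 1" by (simp_all add: e2_def axis_def)
  have "e2 \<in> U" if U: "subrepresentation \<rho> U" "U \<noteq> {0}" for U
  proof -
    have sub: "vec.subspace U" and inv: "\<And>x u. u \<in> U \<Longrightarrow> \<rho> x *v u \<in> U"
      using U by (auto simp: subrepresentation_def)
    obtain u where u: "u \<in> U" "u \<noteq> 0" using U(2) vec.subspace_0 [OF sub] by auto
    show ?thesis
    proof (cases "u $ Inl k0 = 0")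
      case True
      then have "u $ Inr l0 \<noteq> 0" using u eq_iff [of u 0] by simp
      then have "e2 = (1 / u $ Inr l0) *s u" by (simp add: eq_iff e2 True)
      then show ?thesis using vec.subspace_scale [OF sub u(1)] by simp
    next
      case False
      define w where "w = \<rho> gen_s *v u + u"
      have w: "w $ Inl k0 = 0" "w $ Inr l0 = r * u $ Inl k0 + 2 * u $ Inr l0"
        by (simp_all add: w_def mv s mat_def)
      have wU: "w \<in> U"
        unfolding w_def using sub inv u(1) by (simp add: vec.subspace_add)
      define x where "x = \<rho> gen_y1 *v u - a *s u"
      have x: "x $ Inl k0 = 0" "x $ Inr l0 = - u $ Inr l0"
        by (simp_all add: x_def mv y1 mat_def algebra_simps)
      have xU: "x \<in> U"
        unfolding x_def using sub inv u(1) by (simp add: vec.subspace_diff vec.subspace_scale)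
      have "w + 2 *s x \<in> U"
        using sub wU xU by (simp add: vec.subspace_add vec.subspace_scale)
      moreover have "e2 = (1 / (r * u $ Inl k0)) *s (w + 2 *s x)"
        using False r by (simp add: eq_iff e2 w x flip: diff_divide_distrib)
      ultimately show ?thesis using vec.subspace_scale [OF sub] by metis
    qed
  qed
  moreover have "e2 \<noteq> 0" by (simp add: eq_iff e2)
  ultimately have "indecomposable \<rho>"
    unfolding indecomposable_def by blast
  with rep cal reg show "\<rho> \<in> regular_reps" by (simp add: regular_reps_def)
qed

end

theory Submission
  imports Defs
begin

text \<open>
  The joint eigenvalues of \<open>y\<^sub>1, y\<^sub>2\<close> in a regular representation are pairwise distinct, so every
  decomposition into subrepresentations is a decomposition along coordinate subspaces. Hence
  indecomposability means that the graph of nonzero matrix entries of the generators is connected.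
  For \<open>V\<^sub>k\<^sub>,\<^sub>l(S; (a, b))\<close> this is the bipartite graph on rows and columns with the nonzero entries of
  \<open>S\<close> as edges, and its connectedness is rhizomaticity. In general the relations leave only a lower
  left block \<open>R\<close> of \<open>s\<close>; since the eigenvalues are regular and
  \<open>S R = R S = 0\<close>, a nonzero entry of \<open>R\<close> isolates a pair of coordinates, which forces
  \<open>k = l = 1\<close> and the exceptional family. Conjugation acts on representations, and the laws of the
  action on pairs follow from equivariance and injectivity of \<open>(S, (a, b)) \<mapsto> V\<^sub>k\<^sub>,\<^sub>l(S; (a, b))\<close>.
\<close>

section \<open>Matrices\<close>

lemma matrix_inv:
  fixes A :: "complex^'n^'n"
  assumes "invertible A"
  shows matrix_inv_right: "A ** matrix_inv A = mat 1"
    and matrix_inv_left: "matrix_inv A ** A = mat 1"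
  using someI_ex [OF assms [unfolded invertible_def]] by (simp_all add: matrix_inv_def)

lemma matrix_inv_unique:
  fixes A B :: "complex^'n^'n"
  assumes "A ** B = mat 1"
  shows "matrix_inv A = B"
proof -
  have "B ** A = mat 1" using assms by (simp add: matrix_left_right_inverse)
  then have "invertible A" using assms by (auto simp: invertible_def)
  then show ?thesis
    by (metis assms matrix_inv_left matrix_mul_assoc matrix_mul_lid matrix_mul_rid)
qed

lemma matrix_inv_mult:
  fixes A B :: "complex^'n^'n"
  assumes "invertible A" "invertible B"
  shows "matrix_inv (A ** B) = matrix_inv B ** matrix_inv A"
proof (rule matrix_inv_unique)
  have "A ** B ** (matrix_inv B ** matrix_inv A) = A ** (B ** matrix_inv B) ** matrix_inv A"
    by (simp only: matrix_mul_assoc)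
  then show "A ** B ** (matrix_inv B ** matrix_inv A) = mat 1"
    using assms by (simp add: matrix_inv_right)
qed

text \<open>Reduces a conjugation identity to an intertwining relation, which can be checked entry
  by entry without computing \<open>matrix_inv M\<close>.\<close>

lemma conj_eqI:
  fixes M A B :: "complex^'n^'n"
  assumes "invertible M" "M ** A = B ** M"
  shows "M ** A ** matrix_inv M = B"
  by (metis assms matrix_inv_right matrix_mul_assoc matrix_mul_rid)

lemma matrix_vector_mult_axis_nth: "(A *v axis q 1) $ p = (A :: complex^'n^'m) $ p $ q"
  by (simp add: matrix_vector_mult_def axis_def if_distrib sum.delta' sum.delta cong: if_cong)

lemma diag_mult_vector_nth: "(diag d *v u) $ p = d $ p * u $ p"
  by (simp add: matrix_vector_mult_def diag_def if_distrib [where f = "\<lambda>x. x * _"]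
      sum.delta' sum.delta cong: if_cong)

lemma diag_inject [simp]: "diag d = diag d' \<longleftrightarrow> d = d'"
  by (auto simp: diag_def vec_eq_iff)

lemma diag_nth: "diag d $ p $ q = (if p = q then d $ p else 0)"
  by (simp add: diag_def)

text \<open>\<open>A\<close> is block diagonal for the partition of the coordinates into
  \<open>T\<close> and its complement. Equivalently, \<open>T\<close> is a union of connected
  components of the graph whose edges are the nonzero entries of \<open>A\<close>.\<close>

definition decouples :: "'n set \<Rightarrow> complex^'n^'n \<Rightarrow> bool" where
  "decouples T A \<longleftrightarrow> (\<forall>p q. A $ p $ q \<noteq> 0 \<longrightarrow> (p \<in> T \<longleftrightarrow> q \<in> T))"

lemma decouples_diag: "decouples T (diag d)"
  by (auto simp: decouples_def diag_nth)

lemma decouples_mat: "decouples T (mat c)"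
  by (auto simp: decouples_def mat_def)

lemma decouples_add: "decouples T A \<Longrightarrow> decouples T B \<Longrightarrow> decouples T (A + B)"
  unfolding decouples_def by (metis add.right_neutral vector_add_component)

lemma decouples_mult:
  assumes "decouples T A" "decouples T B"
  shows "decouples T (A ** B)"
  unfolding decouples_def
proof (intro allI impI)
  fix p q assume "(A ** B) $ p $ q \<noteq> 0"
  then obtain r where "A $ p $ r * B $ r $ q \<noteq> 0"
    by (auto simp: matrix_matrix_mult_def elim: sum.not_neutral_contains_not_neutral)
  then show "p \<in> T \<longleftrightarrow> q \<in> T" using assms by (auto simp: decouples_def)
qed

lemma matrix_mult_minus_one: "A ** - mat 1 = - A" "- mat 1 ** A = - (A :: complex^'m^'n)"
proof -
  have minus_one: "- mat 1 = (mat (-1) :: complex^'k^'k)" by (simp add: vec_eq_iff mat_def)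
  show "A ** - mat 1 = - A" "- mat 1 ** A = - A"
    unfolding minus_one by (simp_all add: vec_eq_iff mul_mat_nth)
qed

lemma block_inject:
  "block A B C D = block A' B' C' D' \<longleftrightarrow> A = A' \<and> B = B' \<and> C = C' \<and> D = D'"
  unfolding vec_eq_iff split_sum_all block_nth by blast

section \<open>Representations\<close>

lemma gen_relations:
  "gen_s * gen_s = 1" "gen_y1 * gen_y2 = gen_y2 * gen_y1"
  "gen_s * gen_y1 = gen_y2 * gen_s - 1 - gen_e" "gen_s * gen_y2 = gen_y1 * gen_s + 1 - gen_e"
  "gen_e * gen_e = 0" "gen_e * gen_s = gen_e" "gen_s * gen_e = - gen_e"
  "gen_e * gen_y2 = gen_e * gen_y1 + gen_e" "gen_y1 * gen_e = gen_y2 * gen_e + gen_e"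
  by (transfer, rule alg_eq.s_s alg_eq.y1_y2 alg_eq.s_y1 alg_eq.s_y2 alg_eq.e_e alg_eq.e_s
      alg_eq.s_e alg_eq.e_y2 alg_eq.y1_e)+

lemma scal_0: "scal 0 = 0" and scal_1: "scal 1 = 1"
  by (transfer, simp add: zero_alg_term_def one_alg_term_def alg_eq.refl)+

lemma representationD:
  assumes "representation \<rho>"
  shows "\<rho> (x + y) = \<rho> x + \<rho> y" "\<rho> (x * y) = \<rho> x ** \<rho> y" "\<rho> (scal c) = mat c"
    "\<rho> 0 = 0" "\<rho> 1 = mat 1" "\<rho> (- x) = - \<rho> x" "\<rho> (x - y) = \<rho> x - \<rho> y"
proof -
  note hom = assms [unfolded representation_def]
  show add: "\<rho> (x + y) = \<rho> x + \<rho> y" for x y using hom by blast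
  show "\<rho> (x * y) = \<rho> x ** \<rho> y" "\<rho> (scal c) = mat c" using hom by blast+
  show zero: "\<rho> 0 = 0" and "\<rho> 1 = mat 1"
    using hom by (metis mat_zero scal_0, metis scal_1)
  show neg: "\<rho> (- x) = - \<rho> x" for x
    using add [of x "- x"] zero by (simp add: eq_neg_iff_add_eq_0 add.commute)
  show "\<rho> (x - y) = \<rho> x - \<rho> y"
    using add [of x "- y"] by (simp add: neg)
qed

lemma representation_satisfies_relations:
  assumes "representation \<rho>"
  shows "satisfies_relations (\<rho> gen_s) (\<rho> gen_y1) (\<rho> gen_y2) (\<rho> gen_e)"
proof -
  note D = representationD [OF assms]
  show ?thesis
    unfolding satisfies_relations_def D(1,2,4-7) [symmetric] gen_relations by simp
qed

text \<open>Every element is the class of a term, so this is induction on terms. Negation has no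
  case of its own, being multiplication by \<open>Scal (-1)\<close>.\<close>

lemma periplectic_induct [case_names scal s y1 y2 e add mult]:
  assumes "\<And>c. P (scal c)" "P gen_s" "P gen_y1" "P gen_y2" "P gen_e"
    and "\<And>x y. P x \<Longrightarrow> P y \<Longrightarrow> P (x + y)" "\<And>x y. P x \<Longrightarrow> P y \<Longrightarrow> P (x * y)"
  shows "P x"
proof -
  have "P (abs_periplectic t)" for t
  proof (induction t)
    case (Add t u)
    then show ?case using assms(6)
      by (simp add: plus_periplectic.abs_eq [symmetric] flip: plus_alg_term_def)
  next
    case (Mul t u)
    then show ?case using assms(7)
      by (simp add: times_periplectic.abs_eq [symmetric] flip: times_alg_term_def)
  qed (use assms in \<open>simp_all add: gen_s_def gen_y1_def gen_y2_def gen_e_def flip: scal.abs_eq\<close>)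
  then show ?thesis by (metis Quotient3_periplectic Quotient3_abs_rep)
qed

text \<open>For fixed \<open>T\<close> the block diagonal matrices form a unital subalgebra, so the
  generators decide.\<close>

lemma representation_decouples_iff:
  assumes "representation \<rho>"
  shows "(\<forall>x. decouples T (\<rho> x)) \<longleftrightarrow>
    decouples T (\<rho> gen_s) \<and> decouples T (\<rho> gen_y1) \<and> decouples T (\<rho> gen_y2) \<and> decouples T (\<rho> gen_e)"
proof
  assume *: "decouples T (\<rho> gen_s) \<and> decouples T (\<rho> gen_y1) \<and> decouples T (\<rho> gen_y2) \<and>
    decouples T (\<rho> gen_e)"
  show "\<forall>x. decouples T (\<rho> x)"
  proof
    fix x show "decouples T (\<rho> x)"
      by (induction x rule: periplectic_induct)
        (use * in \<open>auto simp: representationD [OF assms] decouples_mat decouples_add decouples_mult\<close>)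
  qed
qed auto

section \<open>Decompositions along coordinate subspaces\<close>

lemma subspace_coordinates: "vec.subspace {u :: complex^'n. \<forall>p. u $ p \<noteq> 0 \<longrightarrow> p \<in> T}"
  unfolding vec.subspace_def by (auto simp: vec_eq_iff) (metis add.right_neutral)

lemma coordinates_invariant:
  assumes "decouples T A" "\<forall>p. u $ p \<noteq> 0 \<longrightarrow> p \<in> T"
  shows "\<forall>p. (A *v u) $ p \<noteq> 0 \<longrightarrow> p \<in> T"
proof (intro allI impI)
  fix p assume "(A *v u) $ p \<noteq> 0"
  then obtain q where "A $ p $ q * u $ q \<noteq> 0"
    by (auto simp: matrix_vector_mult_def elim: sum.not_neutral_contains_not_neutral)
  then show "p \<in> T" using assms by (auto simp: decouples_def)
qed

text \<open>The coordinate subspaces of \<open>T\<close> and of its complement are both invariant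
  and complementary; a nonempty proper \<open>T\<close> would make both of them nonzero.\<close>

lemma indecomposable_imp_trivial:
  fixes \<rho> :: "periplectic \<Rightarrow> complex^'n^'n"
  assumes "indecomposable \<rho>" and T: "\<And>x. decouples T (\<rho> x)"
  shows "T = {} \<or> T = UNIV"
proof (rule ccontr)
  assume nontriv: "\<not> (T = {} \<or> T = UNIV)"
  define C where "C T = {u :: complex^'n. \<forall>p. u $ p \<noteq> 0 \<longrightarrow> p \<in> T}" for T
  have sub: "subrepresentation \<rho> (C T')" if "\<And>x. decouples T' (\<rho> x)" for T'
    unfolding subrepresentation_def C_def
    using subspace_coordinates coordinates_invariant [OF that] by blast
  have T': "decouples (- T) (\<rho> x)" for x using T [of x] by (auto simp: decouples_def)
  have nz: "C T' \<noteq> {0}" if "T' \<noteq> {}" for T'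
  proof -
    obtain p where "p \<in> T'" using \<open>T' \<noteq> {}\<close> by blast
    then have "axis p 1 \<in> C T'" by (simp add: C_def axis_def)
    moreover have "axis p 1 \<noteq> (0 :: complex^'n)" by (simp add: axis_eq_0_iff)
    ultimately show ?thesis by blast
  qed
  have "C T \<inter> C (- T) = {0}"
  proof (intro equalityI subsetI)
    fix u assume "u \<in> C T \<inter> C (- T)"
    then have "u $ p = 0" for p unfolding C_def by blast
    then show "u \<in> {0}" by (simp add: vec_eq_iff)
  qed (simp add: C_def)
  moreover have "\<exists>u\<in>C T. \<exists>w\<in>C (- T). v = u + w" for v
  proof (rule bexI, rule bexI)
    show "v = (\<chi> p. if p \<in> T then v $ p else 0) + (\<chi> p. if p \<in> T then 0 else v $ p)"
      by (simp add: vec_eq_iff)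
  qed (simp_all add: C_def)
  moreover have "C T \<noteq> {0}" "C (- T) \<noteq> {0}" using nz [of T] nz [of "- T"] nontriv by auto
  ultimately show False
    using assms(1) sub [OF T] sub [OF T'] unfolding indecomposable_def by metis
qed

text \<open>Expand \<open>u\<close> in the standard basis and split off the terms whose basis vector
  lies in \<open>U\<close>. The rest lies in \<open>W\<close>, and also in \<open>U\<close> as a
  difference, hence vanishes; so only basis vectors from \<open>U\<close> contribute to
  \<open>u\<close>.\<close>

lemma axis_in_summand:
  fixes U W :: "(complex^'n) set"
  assumes U: "vec.subspace U" and W: "vec.subspace W" and UW: "U \<inter> W = {0}"
    and ax: "\<And>p. axis p 1 \<in> U \<or> axis p 1 \<in> W"
    and u: "u \<in> U" "u $ p \<noteq> 0"
  shows "axis p 1 \<in> U"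
proof (rule ccontr)
  assume p: "axis p 1 \<notin> U"
  let ?t = "\<lambda>q. u $ q *s (axis q 1 :: complex^'n)"
  let ?Q = "{q. axis q (1 :: complex) \<in> U}"
  have split: "u = (\<Sum>q\<in>?Q. ?t q) + (\<Sum>q\<in>- ?Q. ?t q)"
    using basis_expansion [of u] by (subst sum.union_disjoint [symmetric]) (auto simp: Un_def)
  have 1: "(\<Sum>q\<in>?Q. ?t q) \<in> U"
    using U by (intro vec.subspace_sum vec.subspace_scale) auto
  have "(\<Sum>q\<in>- ?Q. ?t q) \<in> W"
    using W ax by (intro vec.subspace_sum vec.subspace_scale) auto
  moreover have "u - (\<Sum>q\<in>?Q. ?t q) = (\<Sum>q\<in>- ?Q. ?t q)"
    unfolding diff_eq_eq by (subst add.commute) (rule split)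
  then have "(\<Sum>q\<in>- ?Q. ?t q) \<in> U"
    using vec.subspace_diff [OF U u(1) 1] by simp
  ultimately have "(\<Sum>q\<in>- ?Q. ?t q) = 0" using UW by blast
  then have "(\<Sum>q\<in>- ?Q. ?t q) $ p = 0" by simp
  moreover have "(\<Sum>q\<in>- ?Q. ?t q) $ p = (\<Sum>q\<in>- ?Q. if q = p then u $ q else 0)"
    unfolding sum_component by (rule sum.cong) (simp_all add: axis_def)
  ultimately show False using p u(2) by (simp add: sum.delta)
qed

text \<open>The components of a common eigenvector with respect to an invariant decomposition
  are common eigenvectors with the same eigenvalues, and these determine the coordinate.\<close>

lemma axis_in_summands:
  fixes \<rho> :: "periplectic \<Rightarrow> complex^'n^'n"
  assumes sep: "\<And>p q. p \<noteq> q \<Longrightarrow> \<exists>x d. \<rho> x = diag d \<and> d $ p \<noteq> d $ q"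
    and U: "subrepresentation \<rho> U" and W: "subrepresentation \<rho> W"
    and UW: "U \<inter> W = {0}" and span: "\<And>v. \<exists>u\<in>U. \<exists>w\<in>W. v = u + w"
  shows "axis p 1 \<in> U \<or> axis p 1 \<in> W"
proof -
  have subU: "vec.subspace U" and subW: "vec.subspace W"
    using U W by (auto simp: subrepresentation_def)
  obtain u w where uw: "u \<in> U" "w \<in> W" "axis p 1 = u + w" using span by blast
  have u0: "u $ q = 0" if "q \<noteq> p" for q
  proof -
    obtain x d where d: "\<rho> x = diag d" "d $ p \<noteq> d $ q" using sep [of p q] \<open>q \<noteq> p\<close> by blast
    \<comment> \<open>This operator kills \<open>axis p 1\<close>, so it sends \<open>u\<close> and
      \<open>w\<close> to opposite vectors, which lie in both summands and are therefore zero. At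
      \<open>q\<close> it multiplies by the nonzero number \<open>d $ q - d $ p\<close>.\<close>
    let ?f = "\<lambda>z. \<rho> x *v z - d $ p *s z"
    have "?f u \<in> U" "?f w \<in> W"
      using U W uw(1,2) subU subW
      by (auto simp: subrepresentation_def intro!: vec.subspace_diff vec.subspace_scale)
    moreover have "?f u = - ?f w"
    proof -
      have "?f u + ?f w = ?f (axis p 1)"
        by (simp add: uw(3) matrix_vector_right_distrib algebra_simps vec_eq_iff)
      also have "\<dots> = 0" by (simp add: vec_eq_iff d(1) diag_mult_vector_nth axis_def)
      finally show ?thesis by (simp only: eq_neg_iff_add_eq_0)
    qed
    ultimately have "?f u \<in> U \<inter> W" using vec.subspace_neg [OF subW] by (metis IntI)
    then have "?f u = 0" using UW by blast
    then have "?f u $ q = 0" by simp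
    then show ?thesis using d by (simp add: diag_mult_vector_nth)
  qed
  then have w0: "w $ q = 0" if "q \<noteq> p" for q
    using arg_cong [OF uw(3), of "\<lambda>z. z $ q"] that by (simp add: axis_def)
  have eq: "u = u $ p *s axis p 1" "w = w $ p *s axis p 1"
    using u0 w0 by (auto simp: vec_eq_iff axis_def)
  have "u $ p + w $ p = 1" using arg_cong [OF uw(3), of "\<lambda>z. z $ p"] by simp
  then consider "u $ p \<noteq> 0" | "w $ p \<noteq> 0" by force
  then show ?thesis
  proof cases
    case 1
    then have "axis p 1 = (1 / u $ p) *s u" by (subst eq) simp
    then show ?thesis using vec.subspace_scale [OF subU uw(1)] by metis
  next
    case 2
    then have "axis p 1 = (1 / w $ p) *s w" by (subst eq) simp
    then show ?thesis using vec.subspace_scale [OF subW uw(2)] by metis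
  qed
qed

text \<open>Separated joint eigenvalues put each standard basis vector into one of two complementary
  summands \<open>U\<close>, \<open>W\<close>. The coordinates whose basis vector lies in
  \<open>U\<close> then form a decoupled set, nonempty and proper because both summands are
  nonzero.\<close>

lemma indecomposable_iff:
  fixes \<rho> :: "periplectic \<Rightarrow> complex^'n^'n"
  assumes sep: "\<And>p q. p \<noteq> q \<Longrightarrow> \<exists>x d. \<rho> x = diag d \<and> d $ p \<noteq> d $ q"
  shows "indecomposable \<rho> \<longleftrightarrow> (\<forall>T. (\<forall>x. decouples T (\<rho> x)) \<longrightarrow> T = {} \<or> T = UNIV)"
proof
  assume triv: "\<forall>T. (\<forall>x. decouples T (\<rho> x)) \<longrightarrow> T = {} \<or> T = UNIV"
  show "indecomposable \<rho>"
    unfolding indecomposable_def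
  proof (intro notI, elim exE conjE)
    fix U W
    assume U: "subrepresentation \<rho> U" and W: "subrepresentation \<rho> W"
      and nz: "U \<noteq> {0}" "W \<noteq> {0}" and UW: "U \<inter> W = {0}"
      and span: "\<forall>v. \<exists>u\<in>U. \<exists>w\<in>W. v = u + w"
    have subU: "vec.subspace U" and subW: "vec.subspace W"
      using U W by (auto simp: subrepresentation_def)
    have ax: "axis p 1 \<in> U \<or> axis p 1 \<in> W" for p
      using axis_in_summands [OF sep U W UW] span by blast
    have "(axis p (1 :: complex) :: complex^'n) \<noteq> 0" for p by simp
    then have notboth: "\<not> (axis p 1 \<in> U \<and> axis p 1 \<in> W)" for p
      using UW by (metis IntI singletonD)
    have nonzero: "\<exists>u\<in>X. \<exists>p. u $ p \<noteq> 0" if X: "vec.subspace X" "X \<noteq> {0}" for X :: "(complex^'n) set"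
    proof -
      obtain u where "u \<in> X" "u \<noteq> 0" using X(2) vec.subspace_0 [OF X(1)] by blast
      then show ?thesis by (auto simp: vec_eq_iff)
    qed
    note inU = axis_in_summand [OF subU subW UW ax]
    \<comment> \<open>The same argument with the two summands exchanged.\<close>
    have WU: "W \<inter> U = {0}" using UW by blast
    have ax': "axis p 1 \<in> W \<or> axis p 1 \<in> U" for p using ax by blast
    note inW = axis_in_summand [OF subW subU WU ax']
    have "decouples {p. axis p 1 \<in> U} (\<rho> x)" for x
      unfolding decouples_def mem_Collect_eq
    proof (intro allI impI)
      fix p q assume "\<rho> x $ p $ q \<noteq> 0"
      then have col: "(\<rho> x *v axis q 1) $ p \<noteq> 0" by (simp add: matrix_vector_mult_axis_nth)
      show "axis p 1 \<in> U \<longleftrightarrow> axis q 1 \<in> U"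
      proof (cases "axis q 1 \<in> U")
        case True
        then show ?thesis using inU [OF _ col] U by (auto simp: subrepresentation_def)
      next
        case False
        then have "axis q 1 \<in> W" using ax by blast
        then have "axis p 1 \<in> W" using inW [OF _ col] W by (auto simp: subrepresentation_def)
        then show ?thesis using notboth False by blast
      qed
    qed
    with triv have "{p. axis p (1 :: complex) \<in> U} = {} \<or> {p. axis p (1 :: complex) \<in> U} = UNIV"
      by blast
    moreover obtain u p where "u \<in> U" "u $ p \<noteq> 0" using nonzero [OF subU nz(1)] by blast
    then have "axis p 1 \<in> U" by (rule inU)
    moreover obtain w q where "w \<in> W" "w $ q \<noteq> 0" using nonzero [OF subW nz(2)] by blast
    then have "axis q 1 \<in> W" by (rule inW)
    ultimately show False using notboth by blast
  qed
qed (use indecomposable_imp_trivial in blast)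

section \<open>Rhizomatic matrices\<close>

text \<open>Connectedness of the bipartite graph with the rows (\<open>Inl\<close>) and columns
  (\<open>Inr\<close>) as vertices and the nonzero entries as edges. Quantifying over vertex sets
  matches the criterion in \<open>indecomposable_iff\<close>.\<close>

definition connected_matrix :: "complex^'l^'k \<Rightarrow> bool" where
  "connected_matrix S \<longleftrightarrow> (\<forall>T :: ('k + 'l) set.
     (\<forall>i j. S $ i $ j \<noteq> 0 \<longrightarrow> (Inl i \<in> T \<longleftrightarrow> Inr j \<in> T)) \<longrightarrow> T = {} \<or> T = UNIV)"

lemma equiv_position_equiv: "equiv (nonzero_positions S) (position_equiv S)"
  by (rule equivI)
    (auto simp: position_equiv_def refl_on_def sym_def trans_def intro: equivclp_sym equivclp_trans)

text \<open>Adjacent positions share a row or a column, and \<open>T\<close> does not separate the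
  two ends of an edge; so membership in \<open>T\<close> is constant along a chain.\<close>

lemma equivclp_adjacent_same_side:
  assumes T: "\<And>i j. S $ i $ j \<noteq> 0 \<Longrightarrow> Inl i \<in> T \<longleftrightarrow> Inr j \<in> T"
    and "equivclp (adjacent S) p q"
  shows "Inl (fst p) \<in> T \<longleftrightarrow> Inl (fst q) \<in> T"
  using assms(2)
proof (induction rule: equivclp_induct)
  case (step y z)
  then have "fst y = fst z \<or> snd y = snd z" "S $ fst y $ snd y \<noteq> 0" "S $ fst z $ snd z \<noteq> 0"
    by (auto simp: adjacent_def nonzero_positions_def)
  then show ?case using step T [of "fst y" "snd y"] T [of "fst z" "snd z"] by auto
qed simp

text \<open>Rhizomaticity speaks of classes of edges, connectedness of components of vertices. The
  two agree because neither allows an isolated row or column.\<close>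

lemma rhizomatic_iff_connected:
  fixes S :: "complex^'l::finite^'k::finite"
  shows "rhizomatic S \<longleftrightarrow> connected_matrix S"
proof
  assume S: "rhizomatic S"
  then have row: "\<exists>j. S $ i $ j \<noteq> 0" and col: "\<exists>i. S $ i $ j \<noteq> 0" for i j
    by (auto simp: rhizomatic_def)
  have one: "(p, q) \<in> position_equiv S"
    if "p \<in> nonzero_positions S" "q \<in> nonzero_positions S" for p q
  proof -
    obtain c where "nonzero_positions S // position_equiv S = {c}"
      using S by (auto simp: rhizomatic_def card_1_singleton_iff)
    then have "position_equiv S `` {p} = position_equiv S `` {q}"
      using quotientI [OF that(1), of "position_equiv S"]
        quotientI [OF that(2), of "position_equiv S"] by auto
    then show ?thesis using eq_equiv_class [OF _ equiv_position_equiv that(2)] by blast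
  qed
  show "connected_matrix S"
    unfolding connected_matrix_def
  proof (intro allI impI)
    fix T :: "('k + 'l) set"
    assume T: "\<forall>i j. S $ i $ j \<noteq> 0 \<longrightarrow> (Inl i \<in> T \<longleftrightarrow> Inr j \<in> T)"
    have l: "Inl i \<in> T \<longleftrightarrow> Inl i' \<in> T" for i i'
    proof -
      obtain j j' where "S $ i $ j \<noteq> 0" "S $ i' $ j' \<noteq> 0" using row by metis
      then have "equivclp (adjacent S) (i, j) (i', j')"
        using one [of "(i, j)" "(i', j')"] by (auto simp: nonzero_positions_def position_equiv_def)
      then show ?thesis using equivclp_adjacent_same_side [of S T] T by fastforce
    qed
    have r: "Inr j \<in> T \<longleftrightarrow> Inl i \<in> T" for i j
      using col [of j] T l by metis
    show "T = {} \<or> T = UNIV"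
    \<comment> \<open>\<open>undefined\<close> stands for an arbitrary row; all rows and columns lie
      on the same side as this one.\<close>
    proof (cases "Inl undefined \<in> T")
      case True
      then have "x \<in> T" for x using l r by (cases x) metis+
      then show ?thesis by blast
    next
      case False
      then have "x \<notin> T" for x using l r by (cases x) metis+
      then show ?thesis by blast
    qed
  qed
next
  assume S: "connected_matrix S"
  \<comment> \<open>A zero row would be an isolated vertex, and its singleton is not everything
    since there is at least one column.\<close>
  have row: "\<exists>j. S $ i $ j \<noteq> 0" for i
    using S [unfolded connected_matrix_def, rule_format, of "{Inl i}"] by auto
  have col: "\<exists>i. S $ i $ j \<noteq> 0" for j
    using S [unfolded connected_matrix_def, rule_format, of "{Inr j}"] by auto
  obtain p where p: "p \<in> nonzero_positions S"
    using row by (force simp: nonzero_positions_def)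
  let ?c = "position_equiv S `` {p}"
  \<comment> \<open>The rows and columns met by the class of \<open>p\<close>. No edge leaves this
    set, because an edge touching it shares a row or column with a member of the class and so
    belongs to the class.\<close>
  define T where "T = Inl ` fst ` ?c \<union> Inr ` snd ` ?c"
  have ext: "q' \<in> ?c"
    if "q \<in> ?c" "q' \<in> nonzero_positions S" "fst q = fst q' \<or> snd q = snd q'" for q q'
  proof -
    have "adjacent S q q'" using that by (auto simp: adjacent_def position_equiv_def)
    then have "equivclp (adjacent S) q q'" by (rule r_into_equivclp)
    then show ?thesis using that by (auto simp: position_equiv_def intro: equivclp_trans)
  qed
  have "Inl i \<in> T \<longleftrightarrow> Inr j \<in> T" if "S $ i $ j \<noteq> 0" for i j
  proof -
    have "(i, j) \<in> nonzero_positions S" using that by (simp add: nonzero_positions_def)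
    then have "Inl i \<in> T \<longleftrightarrow> (i, j) \<in> ?c" "Inr j \<in> T \<longleftrightarrow> (i, j) \<in> ?c"
      using ext [of _ "(i, j)"] unfolding T_def by force+
    then show ?thesis by simp
  qed
  moreover have "p \<in> ?c" using p by (auto simp: position_equiv_def)
  then have "T \<noteq> {}" by (auto simp: T_def)
  ultimately have "T = UNIV" using S unfolding connected_matrix_def by blast
  \<comment> \<open>Every row now meets the class, so each nonzero position shares its row with a
    member.\<close>
  then have "q \<in> ?c" if "q \<in> nonzero_positions S" for q
  proof -
    have "Inl (fst q) \<in> T" using \<open>T = UNIV\<close> by simp
    then obtain q' where "q' \<in> ?c" "fst q' = fst q" unfolding T_def by force
    then show ?thesis using ext that by blast
  qed
  then have "nonzero_positions S // position_equiv S = {?c}"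
    using p by (auto simp: quotient_def)
      (metis (no_types, lifting) Image_singleton_iff equiv_class_eq equiv_position_equiv)+
  then show "rhizomatic S" using row col by (simp add: rhizomatic_def)
qed

section \<open>Regular representations\<close>

lemma rep_of_pair_eqI:
  assumes "representation \<rho>" "\<rho> gen_y1 = pair_y1 v" "\<rho> gen_y2 = pair_y2 v"
    "\<rho> gen_s = pair_s S" "\<rho> gen_e = pair_e S v"
  shows "\<rho> = rep_of_pair (S, v)"
  using ex1_representation [OF satisfies_relations_pair [of S v]] rep_of_pair [of S v] assms
  by blast

section \<open>The eigenvalue vectors of \<open>y1\<close> and \<open>y2\<close>, and injectivity of
  the parametrization\<close>

lemma shift_left_nth [simp]: "shift_left v $ Inl i = v $ Inl i - 1" "shift_left v $ Inr j = v $ Inr j"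
  by (simp_all add: shift_left_def)

lemma shift_right_nth [simp]: "shift_right v $ Inl i = v $ Inl i" "shift_right v $ Inr j = v $ Inr j - 1"
  by (simp_all add: shift_right_def)

text \<open>The matrix is read off from \<open>gen_s\<close> and the vector from
  \<open>gen_y1\<close>. This works for all pairs, so identities between pairs can be tested on
  their representations.\<close>

lemma inj_rep_of_pair: "inj rep_of_pair"
proof (rule injI)
  fix p p' :: "(complex^'l^'k) \<times> (complex^('k + 'l))"
  assume eq: "rep_of_pair p = rep_of_pair p'"
  obtain S v S' v' where p: "p = (S, v)" "p' = (S', v')" by (cases p, cases p')
  have "pair_s S = pair_s S'" "pair_y1 v = pair_y1 v'"
    using eq unfolding p by (metis rep_of_pair(4), metis rep_of_pair(2))
  then show "p = p'"
    unfolding p pair_s_def pair_y1_def diag_inject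
    by (auto simp: vec_eq_sum_iff vec_eq_iff)
qed

lemma shift_right_regular_iff [simp]: "shift_right v \<in> regular_vectors \<longleftrightarrow> v \<in> regular_vectors"
  by (simp add: regular_vectors_def inj_def)

lemma surj_shift_right: "\<exists>v. w = shift_right v"
  by (rule exI [of _ "\<chi> p. case p of Inl i \<Rightarrow> w $ p | Inr j \<Rightarrow> w $ p + 1"])
    (simp add: vec_eq_sum_iff)

lemma pair_y1_minus_y2: "pair_y1 v - pair_y2 v = block (mat 1) 0 0 (- mat 1)"
  by (simp add: vec_eq_sum_iff vec_eq_iff pair_y1_def pair_y2_def diag_nth mat_def)

text \<open>The diagonal of \<open>y1\<close> is \<open>shift_right v\<close>, not \<open>v\<close>
  itself. Lowering all entries of the second part by 1 preserves regularity, and \<open>y2\<close>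
  is recovered from \<open>y1\<close> and the prescribed difference.\<close>

lemma regular_eigenvalues_iff:
  "regular_eigenvalues \<rho> \<longleftrightarrow>
     (\<exists>v\<in>regular_vectors. \<rho> gen_y1 = pair_y1 v \<and> \<rho> gen_y2 = pair_y2 v)"
proof
  assume "regular_eigenvalues \<rho>"
  then obtain w where w: "w \<in> regular_vectors" "\<rho> gen_y1 = diag w"
    and diff: "\<rho> gen_y1 - \<rho> gen_y2 = block (mat 1) 0 0 (- mat 1)"
    by (auto simp: regular_eigenvalues_def)
  obtain v where v: "w = shift_right v" using surj_shift_right by blast
  have y1: "\<rho> gen_y1 = pair_y1 v" using w v by (simp add: pair_y1_def)
  then have "\<rho> gen_y2 = pair_y1 v - (pair_y1 v - pair_y2 v)"
    using diff by (simp add: pair_y1_minus_y2 flip: diff)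
  then show "\<exists>v\<in>regular_vectors. \<rho> gen_y1 = pair_y1 v \<and> \<rho> gen_y2 = pair_y2 v"
    using w v y1 by (intro bexI [of _ v]) simp_all
next
  assume "\<exists>v\<in>regular_vectors. \<rho> gen_y1 = pair_y1 v \<and> \<rho> gen_y2 = pair_y2 v"
  then obtain v where "v \<in> regular_vectors" "\<rho> gen_y1 = pair_y1 v" "\<rho> gen_y2 = pair_y2 v"
    by blast
  then show "regular_eigenvalues \<rho>"
    unfolding regular_eigenvalues_def
    by (auto simp: pair_y1_minus_y2 intro!: bexI [of _ "shift_right v"]) (simp add: pair_y1_def)
qed

lemma calibrated_diag:
  assumes "\<rho> gen_y1 = diag d" "\<rho> gen_y2 = diag d'"
  shows "calibrated \<rho>"
  unfolding calibrated_def
  by (rule exI [of _ "mat 1"]) (simp add: assms matrix_inv_unique invertible_def)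

text \<open>From right to left, \<open>calibrated\<close> holds with the standard basis as
  eigenbasis.\<close>

lemma regular_reps_iff:
  "\<rho> \<in> regular_reps \<longleftrightarrow> representation \<rho> \<and> indecomposable \<rho> \<and>
     (\<exists>v\<in>regular_vectors. \<rho> gen_y1 = pair_y1 v \<and> \<rho> gen_y2 = pair_y2 v)"
  unfolding regular_reps_def regular_eigenvalues_iff
  using calibrated_diag unfolding pair_y1_def pair_y2_def by blast

text \<open>Within one block regularity separates the coordinates; across the blocks
  \<open>y1 - y2\<close> does, being 1 on the first and -1 on the second.\<close>

lemma joint_eigenvalues_distinct:
  assumes "v \<in> regular_vectors" "p \<noteq> q"
  shows "shift_right v $ p \<noteq> shift_right v $ q \<or> shift_left v $ p \<noteq> shift_left v $ q"
  using assms by (cases p; cases q) (auto simp: regular_vectors_def inj_def)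

section \<open>Indecomposability of the representation of a pair\<close>

lemma decouples_block:
  "decouples T (block A B C D) \<longleftrightarrow>
     (\<forall>i i'. A $ i $ i' \<noteq> 0 \<longrightarrow> (Inl i \<in> T \<longleftrightarrow> Inl i' \<in> T)) \<and>
     (\<forall>i j. B $ i $ j \<noteq> 0 \<longrightarrow> (Inl i \<in> T \<longleftrightarrow> Inr j \<in> T)) \<and>
     (\<forall>j i. C $ j $ i \<noteq> 0 \<longrightarrow> (Inr j \<in> T \<longleftrightarrow> Inl i \<in> T)) \<and>
     (\<forall>j j'. D $ j $ j' \<noteq> 0 \<longrightarrow> (Inr j \<in> T \<longleftrightarrow> Inr j' \<in> T))"
  unfolding decouples_def split_sum_all by (simp add: all_conj_distrib conj_ac)

text \<open>\<open>y1\<close> and \<open>y2\<close> are diagonal and the entries of \<open>e\<close>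
  are multiples of those of \<open>S\<close>, so the graph of the generators has exactly the edges
  given by \<open>S\<close>.\<close>

lemma indecomposable_rep_of_pair_iff:
  fixes S :: "complex^'l::finite^'k::finite"
  assumes v: "v \<in> regular_vectors"
  shows "indecomposable (rep_of_pair (S, v)) \<longleftrightarrow> rhizomatic S"
proof -
  let ?\<rho> = "rep_of_pair (S, v)"
  note \<rho> = rep_of_pair [of S v]
  have sep: "\<exists>x d. ?\<rho> x = diag d \<and> d $ p \<noteq> d $ q" if "p \<noteq> q" for p q
    using joint_eigenvalues_distinct [OF v that] \<rho>(2,3) unfolding pair_y1_def pair_y2_def by blast
  have ind: "indecomposable ?\<rho> \<longleftrightarrow>
      (\<forall>T. (\<forall>x. decouples T (?\<rho> x)) \<longrightarrow> T = {} \<or> T = UNIV)"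
    by (rule indecomposable_iff) (rule sep)
  have "(\<forall>x. decouples T (?\<rho> x)) \<longleftrightarrow>
      (\<forall>i j. S $ i $ j \<noteq> 0 \<longrightarrow> (Inl i \<in> T \<longleftrightarrow> Inr j \<in> T))" for T :: "('k + 'l) set"
    unfolding representation_decouples_iff [OF \<rho>(1)] \<rho>(2-5) pair_y1_def pair_y2_def pair_e_eq
    by (auto simp: decouples_diag pair_s_def decouples_block mat_def)
  then show ?thesis
    unfolding ind rhizomatic_iff_connected connected_matrix_def by simp
qed

lemma rep_of_pair_regular_iff: "rep_of_pair p \<in> regular_reps \<longleftrightarrow> p \<in> rhizomatic_pairs"
proof -
  obtain S v where p: "p = (S, v)" by (cases p)
  have "(\<exists>w\<in>regular_vectors. pair_y1 v = pair_y1 w \<and> pair_y2 v = pair_y2 w) \<longleftrightarrow>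
      v \<in> regular_vectors"
    by (metis diag_inject pair_y1_def shift_right_regular_iff)
  then show ?thesis
    unfolding p regular_reps_iff rep_of_pair rhizomatic_pairs_def
    using indecomposable_rep_of_pair_iff [of v S] rep_of_pair(1) [of S v] by auto
qed

text \<open>Comparing entries, the two relations moving \<open>s\<close> past \<open>y1\<close> and
  \<open>y2\<close> fix the diagonal blocks of \<open>s\<close> and express \<open>e\<close> through
  \<open>s\<close>. The relation for \<open>e ** y2\<close> kills the lower left block of
  \<open>e\<close>, which confines \<open>R\<close> to places with equal entries of
  \<open>v\<close>. Finally \<open>s ** s = mat 1\<close> makes both products of \<open>S\<close>
  and \<open>R\<close> vanish.\<close>

lemma relations_block_form:
  fixes v :: "complex^('k::finite + 'l::finite)"
  assumes rel: "satisfies_relations s (pair_y1 v) (pair_y2 v) e"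
  obtains S R where "s = block (- mat 1) S R (mat 1)"
    "e = block 0 (\<chi> i j. (v $ Inl i - v $ Inr j) * S $ i $ j) 0 0"
    "S ** R = 0" "R ** S = 0" "\<forall>i j. v $ Inl i \<noteq> v $ Inr j \<longrightarrow> R $ j $ i = 0"
proof -
  define S where "S = (\<chi> i j. s $ Inl i $ Inr j)"
  define R where "R = (\<chi> j i. s $ Inr j $ Inl i)"
  have ss: "s ** s = mat 1"
    and sy1: "s ** pair_y1 v = pair_y2 v ** s - mat 1 - e"
    and sy2: "s ** pair_y2 v = pair_y1 v ** s + mat 1 - e"
    and ey: "e ** pair_y2 v = e ** pair_y1 v + e"
    using rel by (auto simp: satisfies_relations_def)
  have 1: "s $ p $ q * shift_right v $ q =
      shift_left v $ p * s $ p $ q - mat 1 $ p $ q - e $ p $ q" for p q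
    using arg_cong [OF sy1, of "\<lambda>A. A $ p $ q"]
    by (simp add: pair_y1_def pair_y2_def diag_mult_nth mult_diag_nth)
  have 2: "s $ p $ q * shift_left v $ q =
      shift_right v $ p * s $ p $ q + mat 1 $ p $ q - e $ p $ q" for p q
    using arg_cong [OF sy2, of "\<lambda>A. A $ p $ q"]
    by (simp add: pair_y1_def pair_y2_def diag_mult_nth mult_diag_nth)
  have 3: "e $ p $ q * shift_left v $ q = e $ p $ q * shift_right v $ q + e $ p $ q" for p q
    using arg_cong [OF ey, of "\<lambda>A. A $ p $ q"]
    by (simp add: pair_y1_def pair_y2_def diag_mult_nth mult_diag_nth)
  \<comment> \<open>The difference of \<open>1\<close> and \<open>2\<close>, in which
    \<open>e\<close> cancels. The coefficient of the entry of \<open>s\<close> is 2 in the upper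
    left block, -2 in the lower right one and 0 in the mixed blocks.\<close>
  have diagonal_blocks: "(shift_right v $ p - shift_left v $ p +
      (shift_right v $ q - shift_left v $ q)) * s $ p $ q = - 2 * mat 1 $ p $ q" for p q
  proof -
    have "(shift_right v $ p - shift_left v $ p + (shift_right v $ q - shift_left v $ q)) * s $ p $ q =
        (shift_right v $ p - shift_left v $ p) * s $ p $ q +
        (s $ p $ q * shift_right v $ q - s $ p $ q * shift_left v $ q)"
      by (simp add: algebra_simps)
    also have "\<dots> = - 2 * mat 1 $ p $ q"
      unfolding 1 [of p q] 2 [of p q] by (simp add: algebra_simps)
    finally show ?thesis .
  qed
  have P: "s $ Inl i $ Inl i' = - mat 1 $ i $ i'" for i i'
    using diagonal_blocks [of "Inl i" "Inl i'"] by (simp add: mat_def split: if_splits)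
  have Q: "s $ Inr j $ Inr j' = mat 1 $ j $ j'" for j j'
    using diagonal_blocks [of "Inr j" "Inr j'"] by (simp add: mat_def split: if_splits)
  have s: "s = block (- mat 1) S R (mat 1)"
    by (simp add: vec_eq_sum_iff vec_eq_iff S_def R_def P Q)
  \<comment> \<open>In the columns \<open>Inl i\<close> the relation \<open>3\<close> says that the
    entry equals its own negative.\<close>
  have eR: "e $ Inr j $ Inl i = 0" for i j
    using 3 [of "Inr j" "Inl i"] by (simp add: algebra_simps)
  have e: "e = block 0 (\<chi> i j. (v $ Inl i - v $ Inr j) * S $ i $ j) 0 0"
  proof -
    have e_nth: "e $ p $ q =
        shift_left v $ p * s $ p $ q - mat 1 $ p $ q - s $ p $ q * shift_right v $ q" for p q
      using 1 [of p q] by (simp add: algebra_simps)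
    show ?thesis
      unfolding vec_eq_sum_iff vec_eq_iff split_sum_all block_nth
      using eR by (simp add: e_nth s mat_def algebra_simps)
  qed
  have "S ** R = 0 \<and> R ** S = 0"
    using ss unfolding s block_mult block_eqs(2) [symmetric] block_inject
    by (simp add: matrix_mult_minus_one)
  moreover have "R $ j $ i = 0" if "v $ Inl i \<noteq> v $ Inr j" for i j
  proof -
    have "s $ Inr j $ Inl i * (v $ Inl i - v $ Inr j) = 0"
      using 1 [of "Inr j" "Inl i"] eR by (simp add: mat_def algebra_simps)
    then show ?thesis using that by (simp add: R_def)
  qed
  ultimately show ?thesis using that s e by blast
qed

text \<open>Once the lower left block \<open>R\<close> of \<open>s\<close> vanishes, the generators
  act as for a pair, which is rhizomatic by \<open>rep_of_pair_regular_iff\<close>. A nonzero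
  \<open>R\<close> has to lead to the exceptional family.\<close>

lemma regular_rep_cases:
  fixes \<rho> :: "periplectic \<Rightarrow> complex^('k::finite + 'l::finite)^('k + 'l)"
  assumes \<rho>: "\<rho> \<in> regular_reps" and ne: "\<rho> \<notin> exceptional_reps"
  shows "\<rho> \<in> rep_of_pair ` rhizomatic_pairs"
proof -
  obtain v where rep: "representation \<rho>" and ind: "indecomposable \<rho>"
    and v: "v \<in> regular_vectors" and y: "\<rho> gen_y1 = pair_y1 v" "\<rho> gen_y2 = pair_y2 v"
    using \<rho> by (auto simp: regular_reps_iff)
  have "satisfies_relations (\<rho> gen_s) (pair_y1 v) (pair_y2 v) (\<rho> gen_e)"
    using representation_satisfies_relations [OF rep] by (simp add: y)
  then obtain S R where s: "\<rho> gen_s = block (- mat 1) S R (mat 1)"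
    and e: "\<rho> gen_e = block 0 (\<chi> i j. (v $ Inl i - v $ Inr j) * S $ i $ j) 0 0"
    and SR: "S ** R = 0" "R ** S = 0" and R: "\<forall>i j. v $ Inl i \<noteq> v $ Inr j \<longrightarrow> R $ j $ i = 0"
    by (rule relations_block_form)
  have "R = 0"
  proof (rule ccontr)
    assume "R \<noteq> 0"
    then obtain i j where ij: "R $ j $ i \<noteq> 0" by (auto simp: vec_eq_iff)
    then have vij: "v $ Inl i = v $ Inr j" using R by blast
    have inj: "v $ Inl i' = v $ Inl i'' \<longleftrightarrow> i' = i''" "v $ Inr j' = v $ Inr j'' \<longleftrightarrow> j' = j''"
      for i' i'' j' j'' using v by (auto simp: regular_vectors_def inj_def)
    \<comment> \<open>By regularity no other entry of \<open>v\<close> in the same block has the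
      common value \<open>v $ Inl i = v $ Inr j\<close>, so \<open>R $ j $ i\<close> is alone in its
      row and column.\<close>
    have Ri: "R $ j' $ i = 0" if "j' \<noteq> j" for j' using R vij inj(2) that by metis
    have Rj: "R $ j $ i' = 0" if "i' \<noteq> i" for i' using R vij inj(1) that by metis
    \<comment> \<open>The product with \<open>R\<close> collapses to a single term with the nonzero
      factor \<open>R $ j $ i\<close>, so column \<open>j\<close> of \<open>S\<close> vanishes;
      likewise row \<open>i\<close> below.\<close>
    have Sj: "S $ i' $ j = 0" for i'
    proof -
      have "(\<Sum>j'\<in>UNIV. S $ i' $ j' * R $ j' $ i) = 0"
        using arg_cong [OF SR(1), of "\<lambda>A. A $ i' $ i"] by (simp add: matrix_matrix_mult_def)
      also have "(\<Sum>j'\<in>UNIV. S $ i' $ j' * R $ j' $ i) =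
          (\<Sum>j'\<in>UNIV. if j' = j then S $ i' $ j * R $ j $ i else 0)"
        by (rule sum.cong) (auto simp: Ri)
      finally show ?thesis using ij by simp
    qed
    have Si: "S $ i $ j' = 0" for j'
    proof -
      have "(\<Sum>i'\<in>UNIV. R $ j $ i' * S $ i' $ j') = 0"
        using arg_cong [OF SR(2), of "\<lambda>A. A $ j $ j'"] by (simp add: matrix_matrix_mult_def)
      also have "(\<Sum>i'\<in>UNIV. R $ j $ i' * S $ i' $ j') =
          (\<Sum>i'\<in>UNIV. if i' = i then R $ j $ i * S $ i $ j' else 0)"
        by (rule sum.cong) (auto simp: Rj)
      finally show ?thesis using ij by simp
    qed
    have Sne: "i' \<noteq> i \<and> j' \<noteq> j" if "S $ i' $ j' \<noteq> 0" for i' j' using that Si Sj by metis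
    have Rne: "i' = i \<longleftrightarrow> j' = j" if "R $ j' $ i' \<noteq> 0" for i' j' using that Ri Rj by metis
    \<comment> \<open>No nonzero entry of \<open>S\<close> or \<open>R\<close> joins this pair of
      coordinates to any other.\<close>
    define T :: "('k + 'l) set" where "T = {Inl i, Inr j}"
    have "decouples T (\<rho> x)" for x
    proof -
      have "decouples T (\<rho> gen_s)" "decouples T (\<rho> gen_e)"
        unfolding s e using Sne Rne by (auto simp: decouples_block mat_def T_def)
      then show ?thesis
        using representation_decouples_iff [OF rep, of T] y
        by (simp add: pair_y1_def pair_y2_def decouples_diag)
    qed
    then have "T = UNIV" using indecomposable_imp_trivial [OF ind, of T] by (auto simp: T_def)
    then have only: "i' = i" "j' = j" for i' j' unfolding T_def by blast+
    then have "(UNIV :: 'k set) = {i}" "(UNIV :: 'l set) = {j}" by auto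
    then have "CARD('k) = 1" "CARD('l) = 1" by (metis One_nat_def card_1_singleton_iff)+
    moreover have "v $ Inl i' = v $ Inl i" "v $ Inr j' = v $ Inl i"
      "S $ i' $ j' = 0" "R $ j' $ i' = R $ j $ i"
      for i' j' using only vij Si by metis+
    \<comment> \<open>Both entries of \<open>v\<close> equal \<open>a = v $ Inl i\<close>; the
      shifts produce the entries \<open>a - 1\<close>. \<open>S\<close> is zero because its row
      \<open>i\<close> is, and hence so is \<open>e\<close>.\<close>
    then have "\<rho> gen_y1 = block (mat (v $ Inl i)) 0 0 (mat (v $ Inl i - 1))"
      "\<rho> gen_y2 = block (mat (v $ Inl i - 1)) 0 0 (mat (v $ Inl i))"
      "\<rho> gen_s = block (- mat 1) 0 (\<chi> i' j'. R $ j $ i) (mat 1)" "\<rho> gen_e = 0"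
      unfolding y s e
      by (simp_all add: vec_eq_sum_iff vec_eq_iff pair_y1_def pair_y2_def diag_nth mat_def)
    ultimately have "\<rho> \<in> exceptional_reps"
      using rep ij unfolding exceptional_reps_def by blast
    with ne show False by blast
  qed
  then have "\<rho> = rep_of_pair (S, v)"
    using rep y s e by (intro rep_of_pair_eqI) (simp_all add: pair_s_def pair_e_eq)
  then show ?thesis using \<rho> rep_of_pair_regular_iff by blast
qed

lemma bij_betw_rep_of_pair:
  "bij_betw rep_of_pair rhizomatic_pairs (regular_reps - exceptional_reps)"
  unfolding bij_betw_def
  by (auto simp: rep_of_pair_regular_iff exceptional_not_rep_of_pair
      intro: regular_rep_cases inj_on_subset [OF inj_rep_of_pair])

section \<open>The monomial group and its actions\<close>

lemma monomial_perm:
  assumes "X \<in> monomial_matrices"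
  shows "X $ i $ j \<noteq> 0 \<longleftrightarrow> j = monomial_perm X i"
proof -
  have ex1: "\<exists>!j. X $ i $ j \<noteq> 0" using assms by (simp add: monomial_matrices_def)
  then have "X $ i $ monomial_perm X i \<noteq> 0" unfolding monomial_perm_def by (rule theI')
  then show ?thesis using ex1 by blast
qed

lemma monomial_eq_0:
  "X \<in> monomial_matrices \<Longrightarrow> X $ i $ j = 0 \<longleftrightarrow> j \<noteq> monomial_perm X i"
  using monomial_perm by blast

lemma inj_monomial_perm:
  assumes "X \<in> monomial_matrices"
  shows "inj (monomial_perm X)"
proof (rule injI)
  fix i i' assume "monomial_perm X i = monomial_perm X i'"
  then have "X $ i $ monomial_perm X i \<noteq> 0" "X $ i' $ monomial_perm X i \<noteq> 0"
    using monomial_perm [OF assms] by metis+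
  then show "i = i'" using assms unfolding monomial_matrices_def by blast
qed

lemma monomial_mult_nth:
  assumes "X \<in> monomial_matrices"
  shows "(X ** A) $ i $ j = X $ i $ monomial_perm X i * A $ monomial_perm X i $ j"
proof -
  have "(X ** A) $ i $ j =
      (\<Sum>k\<in>UNIV. if k = monomial_perm X i then X $ i $ k * A $ k $ j else 0)"
    unfolding matrix_matrix_mult_def vec_lambda_beta
    by (rule sum.cong) (simp_all add: monomial_eq_0 [OF assms])
  then show ?thesis by simp
qed

lemma monomial_one: "mat 1 \<in> monomial_matrices"
  by (auto simp: monomial_matrices_def mat_def)

text \<open>The nonzero positions of the product form the graph of the composed permutation, whose
  bijectivity gives the condition on columns.\<close>

lemma monomial_closed:
  assumes X: "X \<in> monomial_matrices" and Y: "Y \<in> monomial_matrices"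
  shows "X ** Y \<in> monomial_matrices"
proof -
  have nz: "(X ** Y) $ i $ k \<noteq> 0 \<longleftrightarrow> k = monomial_perm Y (monomial_perm X i)" for i k
    using monomial_perm [OF X, of i "monomial_perm X i"] monomial_perm [OF Y]
    by (simp add: monomial_mult_nth [OF X])
  have "inj (monomial_perm Y \<circ> monomial_perm X)"
    using inj_monomial_perm [OF X] inj_monomial_perm [OF Y] by (rule inj_compose [rotated])
  then have "bij (monomial_perm Y \<circ> monomial_perm X)"
    by (simp only: bij_def finite_UNIV_inj_surj finite_class.finite_UNIV simp_thms)
  then have "\<exists>!i. k = monomial_perm Y (monomial_perm X i)" for k
    unfolding bij_iff comp_apply by metis
  then show ?thesis by (simp add: monomial_matrices_def nz)
qed

lemma monomial_inverse:
  assumes X: "X \<in> monomial_matrices"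
  shows "\<exists>Y\<in>monomial_matrices. X ** Y = mat 1 \<and> Y ** X = mat 1"
proof (intro bexI conjI)
  \<comment> \<open>The transpose with inverted entries; since \<open>inverse 0 = 0\<close>, it
    keeps the zeros.\<close>
  define Y :: "complex^'a^'a" where "Y = (\<chi> j i. inverse (X $ i $ j))"
  show "Y \<in> monomial_matrices" using X by (simp add: monomial_matrices_def Y_def)
  show XY: "X ** Y = mat 1"
    using monomial_perm [OF X] inj_eq [OF inj_monomial_perm [OF X]]
    by (auto simp: vec_eq_iff monomial_mult_nth [OF X] Y_def mat_def)
  then show "Y ** X = mat 1" by (simp add: matrix_left_right_inverse)
qed

lemma monomial_group_simps:
  "carrier monomial_group = monomial_matrices" "\<one>\<^bsub>monomial_group\<^esub> = mat 1"
  "X \<otimes>\<^bsub>monomial_group\<^esub> Y = X ** Y"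
  by (simp_all add: monomial_group_def)

lemma group_monomial: "group monomial_group"
proof (rule groupI)
  fix X :: "complex^'a^'a" assume "X \<in> carrier monomial_group"
  then show "\<exists>Y\<in>carrier monomial_group. Y \<otimes>\<^bsub>monomial_group\<^esub> X = \<one>\<^bsub>monomial_group\<^esub>"
    using monomial_inverse [of X] by (auto simp: monomial_group_simps)
qed (simp_all add: monomial_group_simps monomial_one monomial_closed matrix_mul_assoc)

lemma invertible_block:
  assumes "X \<in> monomial_matrices" "Y \<in> monomial_matrices"
  shows "invertible (block X 0 0 Y)"
proof -
  obtain X' Y' where "X ** X' = mat 1" "X' ** X = mat 1" "Y ** Y' = mat 1" "Y' ** Y = mat 1"
    using monomial_inverse assms by metis
  then have "block X 0 0 Y ** block X' 0 0 Y' = mat 1 \<and> block X' 0 0 Y' ** block X 0 0 Y = mat 1"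
    by (simp add: block_mult block_eqs)
  then show ?thesis unfolding invertible_def by blast
qed

text \<open>Moving a diagonal matrix across a monomial one permutes its entries; this is the
  permutation of the vector in \<open>pair_action\<close>.\<close>

lemma block_mult_pair_y:
  fixes S :: "complex^'l::finite^'k::finite"
  assumes "X \<in> monomial_matrices" "Y \<in> monomial_matrices"
  shows "block X 0 0 Y ** pair_y1 v = pair_y1 (snd (pair_action (X, Y) (S, v))) ** block X 0 0 Y"
    and "block X 0 0 Y ** pair_y2 v = pair_y2 (snd (pair_action (X, Y) (S, v))) ** block X 0 0 Y"
  by (auto simp: vec_eq_sum_iff vec_eq_iff pair_y1_def pair_y2_def diag_mult_nth mult_diag_nth
      pair_action_def monomial_eq_0 assms)

lemma regular_pair_action:
  assumes "X \<in> monomial_matrices" "Y \<in> monomial_matrices" "v \<in> regular_vectors"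
  shows "snd (pair_action (X, Y) (S, v)) \<in> regular_vectors"
  using assms(3) inj_monomial_perm [OF assms(1)] inj_monomial_perm [OF assms(2)]
  by (auto simp: regular_vectors_def pair_action_def inj_def)

section \<open>Conjugation of representations and its compatibility with the action on pairs\<close>

lemma conj_mult:
  fixes M A B :: "complex^'n^'n"
  assumes "invertible M"
  shows "M ** (A ** B) ** matrix_inv M = (M ** A ** matrix_inv M) ** (M ** B ** matrix_inv M)"
  by (metis assms matrix_inv_left matrix_mul_assoc matrix_mul_rid)

lemma conj_mat:
  fixes M :: "complex^'n^'n"
  assumes "invertible M"
  shows "M ** mat c ** matrix_inv M = mat c"
  by (rule conj_eqI [OF assms]) (simp add: vec_eq_iff mat_mul_nth mul_mat_nth mult.commute)

lemma representation_conj: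
  fixes \<rho> :: "periplectic \<Rightarrow> complex^'n^'n" and M :: "complex^'n^'n"
  assumes "representation \<rho>" "invertible M"
  shows "representation (\<lambda>x. M ** \<rho> x ** matrix_inv M)"
  unfolding representation_def using assms(1)
  by (simp add: representationD conj_mat [OF assms(2)] matrix_add_ldistrib matrix_add_rdistrib')
    (metis assms(2) conj_mult)

text \<open>A decomposition of the conjugate representation pulls back along \<open>M\<close> to one
  of \<open>\<rho>\<close>.\<close>

lemma indecomposable_conj:
  fixes \<rho> :: "periplectic \<Rightarrow> complex^'n^'n" and M :: "complex^'n^'n"
  assumes ind: "indecomposable \<rho>" and M: "invertible M"
  shows "indecomposable (\<lambda>x. M ** \<rho> x ** matrix_inv M)"
  unfolding indecomposable_def
proof (intro notI, elim exE conjE)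
  let ?\<sigma> = "\<lambda>x. M ** \<rho> x ** matrix_inv M" and ?N = "matrix_inv M"
  fix U W
  assume U: "subrepresentation ?\<sigma> U" and W: "subrepresentation ?\<sigma> W"
    and nz: "U \<noteq> {0}" "W \<noteq> {0}" and UW: "U \<inter> W = {0}"
    and span: "\<forall>v. \<exists>u\<in>U. \<exists>w\<in>W. v = u + w"
  have MN: "M *v (?N *v u) = u" and NM: "?N *v (M *v u) = u" for u
    by (simp_all add: matrix_vector_mul_assoc matrix_inv_left [OF M] matrix_inv_right [OF M])
  define C where "C V = {u. M *v u \<in> V}" for V
  have sub: "subrepresentation \<rho> (C V)" if V: "subrepresentation ?\<sigma> V" for V
  proof -
    have "M *v (\<rho> x *v u) \<in> V" if "M *v u \<in> V" for x u
    proof -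
      have "(M ** \<rho> x ** ?N) *v (M *v u) \<in> V" using V that by (auto simp: subrepresentation_def)
      then show ?thesis by (metis NM matrix_vector_mul_assoc)
    qed
    moreover have "vec.subspace (C V)"
      using V unfolding subrepresentation_def vec.subspace_def C_def
      by (auto simp: matrix_vector_right_distrib vector_scalar_commute)
    ultimately show ?thesis by (auto simp: subrepresentation_def C_def)
  qed
  have nzC: "C V \<noteq> {0}" if V: "subrepresentation ?\<sigma> V" "V \<noteq> {0}" for V
  proof -
    have "0 \<in> V" using V(1) vec.subspace_0 by (auto simp: subrepresentation_def)
    then obtain u where u: "u \<in> V" "u \<noteq> 0" using V(2) by blast
    have "?N *v u \<in> C V" using u by (simp add: C_def MN)
    moreover have "?N *v u \<noteq> 0" using u MN [of u] by (metis matrix_vector_mult_0_right)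
    ultimately show ?thesis by blast
  qed
  have "u = 0" if "M *v u \<in> U \<inter> W" for u
    using that UW NM [of u] by (metis matrix_vector_mult_0_right singletonD)
  moreover have "0 \<in> U \<inter> W" using UW by blast
  ultimately have "C U \<inter> C W = {0}" by (auto simp: C_def)
  moreover have "\<exists>u\<in>C U. \<exists>w\<in>C W. v = u + w" for v
  proof -
    obtain u w where uw: "u \<in> U" "w \<in> W" "M *v v = u + w" using span by blast
    then have "v = ?N *v u + ?N *v w" by (metis NM matrix_vector_right_distrib)
    moreover have "?N *v u \<in> C U" "?N *v w \<in> C W" using uw by (simp_all add: C_def MN)
    ultimately show ?thesis by blast
  qed
  ultimately show False
    using ind sub [OF U] sub [OF W] nzC [OF U nz(1)] nzC [OF W nz(2)]
    unfolding indecomposable_def by blast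
qed

lemma rep_action_regular:
  assumes g: "X \<in> monomial_matrices" "Y \<in> monomial_matrices" and \<rho>: "\<rho> \<in> regular_reps"
  shows "rep_action (X, Y) \<rho> \<in> regular_reps"
proof -
  let ?M = "block X 0 0 Y"
  obtain v where v: "v \<in> regular_vectors" "\<rho> gen_y1 = pair_y1 v" "\<rho> gen_y2 = pair_y2 v"
    using \<rho> by (auto simp: regular_reps_iff)
  \<comment> \<open>The vector part of \<open>pair_action\<close> depends only on \<open>v\<close>;
    the zero matrix is a placeholder.\<close>
  define v' where "v' = snd (pair_action (X, Y) (0 :: complex^_^_, v))"
  note M = invertible_block [OF g]
  have "?M ** pair_y1 v ** matrix_inv ?M = pair_y1 v'"
    "?M ** pair_y2 v ** matrix_inv ?M = pair_y2 v'"
    unfolding v'_def by (rule conj_eqI [OF M block_mult_pair_y(1) [OF g]],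
        rule conj_eqI [OF M block_mult_pair_y(2) [OF g]])
  then show ?thesis
    unfolding regular_reps_iff rep_action_def prod.case v
    using \<rho> regular_pair_action [OF g v(1), of 0]
      representation_conj [OF _ M] indecomposable_conj [OF _ M]
    by (auto simp: regular_reps_iff v'_def)
qed

text \<open>Intertwining relations settle \<open>s\<close>, \<open>y1\<close> and \<open>y2\<close>.
  The matrix \<open>e\<close> is a polynomial in these, and conjugation is a unital algebra
  homomorphism, so \<open>e\<close> follows.\<close>

lemma rep_of_pair_action:
  assumes g: "X \<in> monomial_matrices" "Y \<in> monomial_matrices"
  shows "rep_of_pair (pair_action (X, Y) p) = rep_action (X, Y) (rep_of_pair p)"
proof -
  obtain S v where p: "p = (S, v)" by (cases p)
  let ?M = "block X 0 0 Y"
  define S' v' where "S' = X ** S ** matrix_inv Y" and "v' = snd (pair_action (X, Y) (S, v))"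
  have act: "pair_action (X, Y) p = (S', v')"
    by (simp add: p S'_def v'_def pair_action_def)
  note M = invertible_block [OF g]
  have Y: "invertible Y" using monomial_inverse [OF g(2)] by (auto simp: invertible_def)
  \<comment> \<open>The upper right block of the intertwining relation between
    \<open>pair_s S\<close> and \<open>pair_s S'\<close>.\<close>
  have "S' ** Y = X ** S"
    unfolding S'_def by (metis Y matrix_inv_left matrix_mul_assoc matrix_mul_rid)
  then have s: "?M ** pair_s S ** matrix_inv ?M = pair_s S'"
    by (intro conj_eqI [OF M]) (simp add: pair_s_def block_mult matrix_mult_minus_one)
  have y: "?M ** pair_y1 v ** matrix_inv ?M = pair_y1 v'"
    "?M ** pair_y2 v ** matrix_inv ?M = pair_y2 v'"
    unfolding v'_def by (rule conj_eqI [OF M block_mult_pair_y(1) [OF g]],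
        rule conj_eqI [OF M block_mult_pair_y(2) [OF g]])
  have conj_add: "?M ** (A + B) ** matrix_inv ?M =
      ?M ** A ** matrix_inv ?M + ?M ** B ** matrix_inv ?M" for A B
    by (simp add: matrix_add_ldistrib matrix_add_rdistrib')
  have conj_neg: "?M ** (- A) ** matrix_inv ?M = - (?M ** A ** matrix_inv ?M)" for A
    using conj_add [of A "- A"] by (simp add: eq_neg_iff_add_eq_0 add.commute)
  have "?M ** pair_e S v ** matrix_inv ?M = pair_e S' v'"
    unfolding pair_e_def conj_add conj_neg conj_mult [OF M] conj_mat [OF M] s y ..
  then have "rep_action (X, Y) (rep_of_pair p) = rep_of_pair (S', v')"
    using rep_of_pair [of S v] s y representation_conj [OF _ M]
    by (intro rep_of_pair_eqI) (simp_all add: rep_action_def p)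
  then show ?thesis by (simp add: act)
qed

lemma rep_action_one: "rep_action (mat 1, mat 1) \<rho> = \<rho>"
  by (simp add: rep_action_def block_eqs matrix_inv_unique)

lemma rep_action_mult:
  assumes "X \<in> monomial_matrices" "Y \<in> monomial_matrices"
    "X' \<in> monomial_matrices" "Y' \<in> monomial_matrices"
  shows "rep_action (X ** X', Y ** Y') \<rho> = rep_action (X, Y) (rep_action (X', Y') \<rho>)"
proof -
  have "block (X ** X') 0 0 (Y ** Y') = block X 0 0 Y ** block X' 0 0 Y'"
    by (simp add: block_mult)
  then show ?thesis
    by (simp add: rep_action_def matrix_inv_mult invertible_block assms matrix_mul_assoc)
qed

text \<open>\<open>group_action\<close> asks for a homomorphism into \<open>BijGroup E\<close>,
  whose elements are extensional on \<open>E\<close>; hence the restriction. The inverse group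
  element provides the inverse bijection.\<close>

lemma group_action_restrictI:
  assumes "group G"
    and closed: "\<And>g x. g \<in> carrier G \<Longrightarrow> x \<in> E \<Longrightarrow> \<phi> g x \<in> E"
    and one: "\<And>x. x \<in> E \<Longrightarrow> \<phi> \<one>\<^bsub>G\<^esub> x = x"
    and mult: "\<And>g h x. g \<in> carrier G \<Longrightarrow> h \<in> carrier G \<Longrightarrow> x \<in> E \<Longrightarrow>
      \<phi> (g \<otimes>\<^bsub>G\<^esub> h) x = \<phi> g (\<phi> h x)"
  shows "group_action G E (\<lambda>g. restrict (\<phi> g) E)"
proof -
  interpret group G by fact
  have inv: "\<phi> (inv\<^bsub>G\<^esub> g) (\<phi> g x) = x" "\<phi> g (\<phi> (inv\<^bsub>G\<^esub> g) x) = x"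
    if "g \<in> carrier G" "x \<in> E" for g x
    using that by (simp_all add: one flip: mult)
  have "bij_betw (\<phi> g) E E" if "g \<in> carrier G" for g
    using that inv closed by (intro bij_betw_byWitness [where f' = "\<phi> (inv\<^bsub>G\<^esub> g)"]) auto
  then have "restrict (\<phi> g) E \<in> Bij E" if "g \<in> carrier G" for g
    using that by (simp add: Bij_def bij_betw_restrict_eq)
  then have "(\<lambda>g. restrict (\<phi> g) E) \<in> hom G (BijGroup E)"
    using closed mult by (auto simp: hom_def BijGroup_def compose_def fun_eq_iff)
  then show ?thesis
    using group_BijGroup by (simp add: group_action_def group_hom_def group_hom_axioms_def)
qed

theorem theorem20:
  shows
    "group_action ((monomial_group :: (complex^'k^'k) monoid) \<times>\<times> (monomial_group :: (complex^'l^'l) monoid))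
       (regular_reps :: (periplectic \<Rightarrow> complex^('k + 'l)^('k + 'l)) set)
       (\<lambda>g. restrict (rep_action g) regular_reps)
   \<and> group_action ((monomial_group :: (complex^'k^'k) monoid) \<times>\<times> (monomial_group :: (complex^'l^'l) monoid))
       (rhizomatic_pairs :: ((complex^'l^'k) \<times> (complex^('k + 'l))) set)
       (\<lambda>g. restrict (pair_action g) rhizomatic_pairs)
   \<and> bij_betw rep_of_pair
       (rhizomatic_pairs :: ((complex^'l^'k) \<times> (complex^('k + 'l))) set)
       (regular_reps - exceptional_reps)
   \<and> (\<forall>g \<in> carrier ((monomial_group :: (complex^'k^'k) monoid) \<times>\<times> (monomial_group :: (complex^'l^'l) monoid)).
        \<forall>p \<in> (rhizomatic_pairs :: ((complex^'l^'k) \<times> (complex^('k + 'l))) set).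
          rep_of_pair (pair_action g p) = rep_action g (rep_of_pair p))"
proof (intro conjI)
  let ?G = "(monomial_group :: (complex^'k^'k) monoid) \<times>\<times> (monomial_group :: (complex^'l^'l) monoid)"
  have G: "group ?G" by (intro DirProd_group group_monomial)
  show "group_action ?G
      (regular_reps :: (periplectic \<Rightarrow> complex^('k + 'l)^('k + 'l)) set)
      (\<lambda>g. restrict (rep_action g) regular_reps)"
    by (rule group_action_restrictI [OF G])
      (auto simp: monomial_group_simps rep_action_regular rep_action_one rep_action_mult)
  show equivariant: "\<forall>g\<in>carrier ?G.
      \<forall>p\<in>(rhizomatic_pairs :: ((complex^'l^'k) \<times> (complex^('k + 'l))) set).
        rep_of_pair (pair_action g p) = rep_action g (rep_of_pair p)"
    by (auto simp: monomial_group_simps rep_of_pair_action)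
  \<comment> \<open>Applying the injective equivariant map \<open>rep_of_pair\<close> to both sides
    turns each law for pairs into the corresponding law for conjugation.\<close>
  note inj = injD [OF inj_rep_of_pair]
  show "group_action ?G
      (rhizomatic_pairs :: ((complex^'l^'k) \<times> (complex^('k + 'l))) set)
      (\<lambda>g. restrict (pair_action g) rhizomatic_pairs)"
  proof (rule group_action_restrictI [OF G])
    fix g h and p :: "(complex^'l^'k) \<times> (complex^('k + 'l))"
    assume g: "g \<in> carrier ?G" and p: "p \<in> rhizomatic_pairs"
    \<comment> \<open>A pair is rhizomatic with regular vector exactly when its representation is
      regular, and conjugation preserves the latter.\<close>
    show "pair_action g p \<in> rhizomatic_pairs"
      using g p by (auto simp: monomial_group_simps rep_of_pair_action rep_action_regular
          simp flip: rep_of_pair_regular_iff)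
    assume h: "h \<in> carrier ?G"
    show "pair_action (g \<otimes>\<^bsub>?G\<^esub> h) p = pair_action g (pair_action h p)"
      using g h by (intro inj)
        (auto simp: monomial_group_simps rep_of_pair_action rep_action_mult monomial_closed)
  next
    fix p :: "(complex^'l^'k) \<times> (complex^('k + 'l))"
    show "pair_action \<one>\<^bsub>?G\<^esub> p = p"
      by (intro inj) (simp add: monomial_group_simps rep_of_pair_action monomial_one rep_action_one)
  qed
qed (rule bij_betw_rep_of_pair)

end
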